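(* Let $f:\mathbb{R}^n\to\mathbb{R}$ be convex and $L_f$-smooth with a minimizer $x^*$, let $\rho>0$, and run the Accelerated Proximal Bundle Method (a-PBM, described in the context) from $x_0\in\mathbb{R}^n$. There exist constants $A>0$ and $M>0$, independent of $\epsilon$ and of the iteration indices, such that for every $\epsilon\in(0,1)$: (a) for every serious step $k$ and every index $j>k$ in the sequence of null steps following it, if $\xi_j\le A\epsilon^3$ and the null step test is not satisfied at iteration $j$, then $f(y_j)-f(x^* )\le\epsilon$; (b) $\xi_{k+1}\le M/\epsilon^2$ for every serious step $k$; and such that the algorithm reaches an $\epsilon$-optimal solution in at most the following number of iterations: $$\left(\frac{\sqrt{2\rho}\,\|x_0-x^*\|}{\sqrt{\epsilon}}+1\right)\left(\frac{5\log(\frac1\epsilon)+\log\left(\frac{M}{A}\right)}{\log\left(1+\left(\frac{L_f}{\rho}+\frac{8L_f^2}{\rho^2}+\frac{16L_f^3}{\rho^3}\right)^{-1}\right)}+1\right).$$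
   Context: $L_f$-smooth: differentiable with $\|\nabla f(y)-\nabla f(x)\|\le L_f\|x-y\|$ for all $x,y$ ($L_f>0$). A point $x$ is $\epsilon$-optimal if $f(x)-f(x^* )\le\epsilon$; an $\epsilon$-optimal solution is reached when one of the generated points ($y_k$ or $\zeta_k$) is $\epsilon$-optimal. Accelerated Proximal Bundle Method (a-PBM). Input: $x_0$, a finite index set $\mathcal{I}_0\ni 0$ of initial cuts with associated points $y_i$ ($i\in\mathcal{I}_0$), $\rho>0$, and $C=\frac{2L_f}{\rho}\big(\sqrt{2L_f/\rho}+1\big)$. Set $\zeta_0=x_0$, $t_0=1$. For $k=0,1,2,\dots$: (1) let $y_{k+1}$ be the $y$-component of the solution of $\min_{t\in\mathbb{R},y\in\mathbb{R}^n}\,t+\frac\rho2\|y-x_k\|^2$ subject to $t-f(y_i)-\langle\nabla f(y_i),y-y_i\rangle\ge\frac{\rho^2}{2L_f}\|y-x_k+\frac1\rho\nabla f(y_i)\|^2$ for all $i\in\mathcal{I}_k$; (2) $\mathcal{I}_{k+1}=\mathcal{I}_k\cup\{k+1\}$; (3) null step test: if $C\|y_{k+1}-y_k\|\le\|x_k-y_{k+1}\|$ (serious step), set $t_{k+1}=\frac{1+\sqrt{1+4t_k^2}}2$, $\zeta_{k+1}=x_k-\frac1\rho\nabla f(y_{k+1})$, $x_{k+1}=\zeta_{k+1}+\frac{t_k-1}{t_{k+1}}(\zeta_{k+1}-\zeta_k)$; otherwise (null step), set $x_{k+1}=x_k$, $\zeta_{k+1}=\zeta_k$, $t_{k+1}=t_k$.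 Indexing convention: "serious step $k$" means that $x_k$ is a newly set proximal center (or $k=0$); an index $j>k$ is in the sequence of null steps following it if iterations $k,\dots,j-1$ were null steps, so that $x_j=x_k$. The null step test fails at iteration $j$ when $C\|y_{j+1}-y_j\|>\|x_k-y_{j+1}\|$. $f_j$ denotes the pointwise lowest function among all convex $L_f$-smooth functions $\hat f:\mathbb{R}^n\to\mathbb{R}$ with $\hat f(y_i)=f(y_i)$, $\nabla\hat f(y_i)=\nabla f(y_i)$ for all $i\in\mathcal{I}_j$ (it exists, and $y_{j+1}$ minimizes $f_j+\frac\rho2\|\cdot-x_j\|^2$). For a serious step $k$ and $j>k$ in the corresponding sequence, $m_j=f_{j-1}(y_j)+\frac\rho2\|y_j-x_k\|^2$, $z_j\in\arg\min_{z\in\{y_{k+1},\dots,y_j\}}\{f(z)+\frac\rho2\|z-x_k\|^2\}$, and $\xi_j=f(z_j)+\frac\rho2\|z_j-x_k\|^2-m_j$. *)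

theory Defs
  imports "HOL-Analysis.Analysis"
begin

definition grad :: "('a::euclidean_space \<Rightarrow> real) \<Rightarrow> 'a \<Rightarrow> 'a" where
  "grad f x = (THE D. GDERIV f x :> D)"

definition L_smooth :: "real \<Rightarrow> ('a::euclidean_space \<Rightarrow> real) \<Rightarrow> bool" where
  "L_smooth L f \<longleftrightarrow> 0 < L \<and> (\<forall>x. f differentiable (at x)) \<and>
     (\<forall>x y. norm (grad f y - grad f x) \<le> L * norm (x - y))"

text \<open>
  Cut points are indexed by integers: the initial cuts have indices in a finite set of
  nonpositive integers containing 0, and iteration \<open>k\<close> generates the point with
  index \<open>k + 1\<close>, so the generated indices never clash with the initial ones.
  \<open>I k\<close> is the index set of the cuts available at iteration \<open>k\<close>.
\<close>

definition qp_feasible ::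
  "('a::euclidean_space \<Rightarrow> real) \<Rightarrow> real \<Rightarrow> real \<Rightarrow> int set \<Rightarrow> (int \<Rightarrow> 'a) \<Rightarrow> 'a \<Rightarrow> real \<times> 'a \<Rightarrow> bool" where
  "qp_feasible f L \<rho> J y c = (\<lambda>(s, u). \<forall>i\<in>J.
     s - f (y i) - grad f (y i) \<bullet> (u - y i)
       \<ge> \<rho>\<^sup>2 / (2 * L) * (norm (u - c + (1 / \<rho>) *\<^sub>R grad f (y i)))\<^sup>2)"

definition qp_solution ::
  "('a::euclidean_space \<Rightarrow> real) \<Rightarrow> real \<Rightarrow> real \<Rightarrow> int set \<Rightarrow> (int \<Rightarrow> 'a) \<Rightarrow> 'a \<Rightarrow> real \<times> 'a \<Rightarrow> bool" where
  "qp_solution f L \<rho> J y c =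
     is_arg_min (\<lambda>(s, u). s + \<rho> / 2 * (norm (u - c))\<^sup>2) (qp_feasible f L \<rho> J y c)"

definition step_const :: "real \<Rightarrow> real \<Rightarrow> real" where
  "step_const L \<rho> = 2 * L / \<rho> * (sqrt (2 * L / \<rho>) + 1)"

definition serious_iteration ::
  "real \<Rightarrow> real \<Rightarrow> (int \<Rightarrow> 'a::euclidean_space) \<Rightarrow> (nat \<Rightarrow> 'a) \<Rightarrow> nat \<Rightarrow> bool" where
  "serious_iteration L \<rho> y x k \<longleftrightarrow>
     step_const L \<rho> * norm (y (int k + 1) - y (int k)) \<le> norm (x k - y (int k + 1))"

definition a_PBM ::
  "('a::euclidean_space \<Rightarrow> real) \<Rightarrow> real \<Rightarrow> real \<Rightarrow> (nat \<Rightarrow> int set) \<Rightarrow> (int \<Rightarrow> 'a) \<Rightarrow>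
   (nat \<Rightarrow> 'a) \<Rightarrow> (nat \<Rightarrow> 'a) \<Rightarrow> (nat \<Rightarrow> real) \<Rightarrow> bool" where
  "a_PBM f L \<rho> I y x \<zeta> t \<longleftrightarrow>
     finite (I 0) \<and> 0 \<in> I 0 \<and> I 0 \<subseteq> {..0} \<and> \<zeta> 0 = x 0 \<and> t 0 = 1 \<and>
     (\<forall>k. (\<exists>s. qp_solution f L \<rho> (I k) y (x k) (s, y (int k + 1))) \<and>
          I (Suc k) = I k \<union> {int k + 1} \<and>
          (if serious_iteration L \<rho> y x k
           then t (Suc k) = (1 + sqrt (1 + 4 * (t k)\<^sup>2)) / 2 \<and>
                \<zeta> (Suc k) = x k - (1 / \<rho>) *\<^sub>R grad f (y (int k + 1)) \<and>
                x (Suc k) = \<zeta> (Suc k) + ((t k - 1) / t (Suc k)) *\<^sub>R (\<zeta> (Suc k) - \<zeta> k)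
           else x (Suc k) = x k \<and> \<zeta> (Suc k) = \<zeta> k \<and> t (Suc k) = t k))"

text \<open>
  The step index \<open>k\<close> counts as serious when the center \<open>x k\<close> has just been set, i.e. when
  the preceding iteration \<open>k - 1\<close> passed the test; the sequence of null steps following it
  contains the indices \<open>j\<close> for which iterations \<open>k, \<dots>, j - 1\<close> were all null.
\<close>

definition serious_step ::
  "real \<Rightarrow> real \<Rightarrow> (int \<Rightarrow> 'a::euclidean_space) \<Rightarrow> (nat \<Rightarrow> 'a) \<Rightarrow> nat \<Rightarrow> bool" where
  "serious_step L \<rho> y x k \<longleftrightarrow> k = 0 \<or> serious_iteration L \<rho> y x (k - 1)"

definition in_null_sequence ::
  "real \<Rightarrow> real \<Rightarrow> (int \<Rightarrow> 'a::euclidean_space) \<Rightarrow> (nat \<Rightarrow> 'a) \<Rightarrow> nat \<Rightarrow> nat \<Rightarrow> bool" where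
  "in_null_sequence L \<rho> y x k j \<longleftrightarrow> k < j \<and> (\<forall>i\<in>{k..<j}. \<not> serious_iteration L \<rho> y x i)"

definition interpolant ::
  "('a::euclidean_space \<Rightarrow> real) \<Rightarrow> real \<Rightarrow> int set \<Rightarrow> (int \<Rightarrow> 'a) \<Rightarrow> ('a \<Rightarrow> real) \<Rightarrow> bool" where
  "interpolant f L J y g \<longleftrightarrow> convex_on UNIV g \<and> L_smooth L g \<and>
     (\<forall>i\<in>J. g (y i) = f (y i) \<and> grad g (y i) = grad f (y i))"

text \<open>The least element below is taken in the pointwise order on functions.\<close>

definition lower_model ::
  "('a::euclidean_space \<Rightarrow> real) \<Rightarrow> real \<Rightarrow> int set \<Rightarrow> (int \<Rightarrow> 'a) \<Rightarrow> 'a \<Rightarrow> real" where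
  "lower_model f L J y = (LEAST g. interpolant f L J y g)"

definition model_value ::
  "('a::euclidean_space \<Rightarrow> real) \<Rightarrow> real \<Rightarrow> real \<Rightarrow> (nat \<Rightarrow> int set) \<Rightarrow> (int \<Rightarrow> 'a) \<Rightarrow>
   (nat \<Rightarrow> 'a) \<Rightarrow> nat \<Rightarrow> nat \<Rightarrow> real" where
  "model_value f L \<rho> I y x k j =
     lower_model f L (I (j - 1)) y (y (int j)) + \<rho> / 2 * (norm (y (int j) - x k))\<^sup>2"

definition best_point ::
  "('a::euclidean_space \<Rightarrow> real) \<Rightarrow> real \<Rightarrow> (int \<Rightarrow> 'a) \<Rightarrow> (nat \<Rightarrow> 'a) \<Rightarrow> nat \<Rightarrow> nat \<Rightarrow> 'a \<Rightarrow> bool" where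
  "best_point f \<rho> y x k j =
     is_arg_min (\<lambda>z. f z + \<rho> / 2 * (norm (z - x k))\<^sup>2) (\<lambda>z. z \<in> y ` {int k + 1..int j})"

definition gap ::
  "('a::euclidean_space \<Rightarrow> real) \<Rightarrow> real \<Rightarrow> real \<Rightarrow> (nat \<Rightarrow> int set) \<Rightarrow> (int \<Rightarrow> 'a) \<Rightarrow>
   (nat \<Rightarrow> 'a) \<Rightarrow> nat \<Rightarrow> nat \<Rightarrow> 'a \<Rightarrow> real" where
  "gap f L \<rho> I y x k j z =
     f z + \<rho> / 2 * (norm (z - x k))\<^sup>2 - model_value f L \<rho> I y x k j"

end

theory Submission
  imports Defs
begin

text \<open>
  The lowest convex \<open>L\<close>-smooth interpolant is the Moreau envelope of a maximum of shifted cuts,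
  and the quadratic program computes its proximal point, so \<open>y (k + 1)\<close> minimizes
  \<open>model k + \<rho> / 2 * norm (_ - x k)\<^sup>2\<close>.

  Along null steps write \<open>d = norm (y (j + 1) - y j)\<close>. Strong convexity raises the model value by at
  least \<open>\<rho> / 2 * d\<^sup>2\<close>, whereas the new gap is at most \<open>L / 2 * d\<^sup>2\<close> because the model and \<open>f\<close> are
  tangent at \<open>y j\<close>. The gap thus contracts by \<open>1 + \<rho> / L\<close>, which is at least as good as the claimed
  rate. A null step with gap \<open>\<xi>\<close> forces \<open>y j\<close>, \<open>y (j + 1)\<close> and \<open>x k\<close> to be within \<open>O(sqrt \<xi>)\<close> of each
  other, so the model gradient at \<open>y j\<close> and hence \<open>f (y j) - f xstar\<close> are \<open>O(sqrt \<xi>)\<close>.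

  At serious steps the test makes \<open>\<zeta> (k + 1)\<close> an accurate enough proximal gradient step that the
  usual energy of accelerated gradient descent does not increase. This gives both the rate in the
  number of serious steps and the uniform bound on all iterates on which \<open>A\<close> and \<open>M\<close> depend.
\<close>

subsection \<open>Convex smooth functions\<close>

lemma gderiv_unique:
  fixes f :: "'a::euclidean_space \<Rightarrow> real"
  assumes "GDERIV f x :> D" "GDERIV f x :> E"
  shows "D = E"
proof -
  have "(\<lambda>h. h \<bullet> D) = (\<lambda>h. h \<bullet> E)"
    using assms unfolding gderiv_def by (rule has_derivative_unique)
  then show ?thesis by (metis vector_eq_ldot)
qed

lemma grad_eqI: "GDERIV f x :> D \<Longrightarrow> grad f x = D"
  unfolding grad_def using gderiv_unique by blast

lemma gderiv_grad:
  fixes f :: "'a::euclidean_space \<Rightarrow> real"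
  assumes "f differentiable (at x)"
  shows "GDERIV f x :> grad f x"
proof -
  obtain D where D: "(f has_derivative D) (at x)"
    using assms unfolding differentiable_def by blast
  interpret D: linear D using D by (rule has_derivative_linear)
  define G where "G = (\<Sum>b\<in>Basis. D b *\<^sub>R b)"
  have "D h = h \<bullet> G" for h
  proof -
    have "D h = D (\<Sum>b\<in>Basis. (h \<bullet> b) *\<^sub>R b)" by (simp add: euclidean_representation)
    also have "\<dots> = h \<bullet> G" by (simp add: D.sum D.scale G_def inner_sum_right mult.commute)
    finally show ?thesis .
  qed
  then have "D = (\<lambda>h. h \<bullet> G)" by (rule ext)
  then have "GDERIV f x :> G" using D by (simp add: gderiv_def)
  then show ?thesis using grad_eqI by metis
qed

lemma gderiv_along_line:
  fixes f :: "'a::euclidean_space \<Rightarrow> real"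
  assumes "GDERIV f (u + s *\<^sub>R d) :> G"
  shows "DERIV (\<lambda>s. f (u + s *\<^sub>R d)) s :> d \<bullet> G"
proof -
  have "((\<lambda>s. u + s *\<^sub>R d) has_derivative (\<lambda>h. h *\<^sub>R d)) (at s)"
    by (auto intro!: derivative_eq_intros)
  moreover have "(f has_derivative (\<lambda>h. h \<bullet> G)) (at (u + s *\<^sub>R d))"
    using assms unfolding gderiv_def .
  ultimately have "((\<lambda>s. f (u + s *\<^sub>R d)) has_derivative (\<lambda>h. (h *\<^sub>R d) \<bullet> G)) (at s)"
    by (rule has_derivative_compose)
  then show ?thesis by (simp add: has_field_derivative_def mult_commute_abs)
qed

lemma convex_smooth_above_tangent:
  assumes f: "convex_on UNIV f" "L_smooth L f"
  shows "f v \<ge> f u + grad f u \<bullet> (v - u)"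
proof -
  have "DERIV (\<lambda>s. f (u + s *\<^sub>R (v - u))) 0 :> (v - u) \<bullet> grad f u"
    using gderiv_grad[of f u] f by (intro gderiv_along_line) (simp add: L_smooth_def)
  moreover have "convex_on UNIV (\<lambda>s::real. f (u + s *\<^sub>R (v - u)))"
  proof (rule convex_onI)
    fix t a b :: real assume t: "0 < t" "t < 1"
    have "u + ((1 - t) *\<^sub>R a + t *\<^sub>R b) *\<^sub>R (v - u)
        = (1 - t) *\<^sub>R (u + a *\<^sub>R (v - u)) + t *\<^sub>R (u + b *\<^sub>R (v - u))"
      by (simp add: algebra_simps)
    then show "f (u + ((1 - t) *\<^sub>R a + t *\<^sub>R b) *\<^sub>R (v - u))
        \<le> (1 - t) * f (u + a *\<^sub>R (v - u)) + t * f (u + b *\<^sub>R (v - u))"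
      using convex_onD[OF f(1), of t "u + a *\<^sub>R (v - u)" "u + b *\<^sub>R (v - u)"] t by simp
  qed simp
  ultimately have "f (u + 1 *\<^sub>R (v - u)) - f (u + 0 *\<^sub>R (v - u)) \<ge> ((v - u) \<bullet> grad f u) * (1 - 0)"
    by (intro convex_on_imp_above_tangent[where A = UNIV]) auto
  then show ?thesis by (simp add: inner_commute)
qed

lemma smooth_below_quadratic:
  assumes f: "L_smooth L f"
  shows "f v \<le> f u + grad f u \<bullet> (v - u) + L / 2 * (norm (v - u))\<^sup>2"
proof -
  define d where "d = v - u"
  define \<phi> where "\<phi> s = f (u + s *\<^sub>R d) - s * (d \<bullet> grad f u) - L / 2 * s\<^sup>2 * (norm d)\<^sup>2" for s
  have "\<phi> 1 \<le> \<phi> 0"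
  proof (rule DERIV_nonpos_imp_nonincreasing[of 0 1 \<phi>])
    fix s :: real assume s: "0 \<le> s" "s \<le> 1"
    have "DERIV (\<lambda>s. f (u + s *\<^sub>R d)) s :> d \<bullet> grad f (u + s *\<^sub>R d)"
      using gderiv_grad[of f "u + s *\<^sub>R d"] f by (intro gderiv_along_line) (auto simp: L_smooth_def)
    then have D: "DERIV \<phi> s :> d \<bullet> grad f (u + s *\<^sub>R d) - d \<bullet> grad f u - L * s * (norm d)\<^sup>2"
      unfolding \<phi>_def by (auto intro!: derivative_eq_intros)
    have "d \<bullet> (grad f (u + s *\<^sub>R d) - grad f u) \<le> norm d * norm (grad f (u + s *\<^sub>R d) - grad f u)"
      by (rule norm_cauchy_schwarz)
    moreover have "norm (grad f (u + s *\<^sub>R d) - grad f u) \<le> L * (s * norm d)"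
    proof -
      have "norm (grad f (u + s *\<^sub>R d) - grad f u) \<le> L * norm (u - (u + s *\<^sub>R d))"
        using f unfolding L_smooth_def by blast
      then show ?thesis using s by (simp add: norm_minus_commute)
    qed
    then have "norm d * norm (grad f (u + s *\<^sub>R d) - grad f u) \<le> norm d * (L * (s * norm d))"
      by (intro mult_left_mono) auto
    ultimately have "d \<bullet> grad f (u + s *\<^sub>R d) - d \<bullet> grad f u - L * s * (norm d)\<^sup>2 \<le> 0"
      by (simp add: inner_diff_right power2_eq_square mult_ac)
    with D show "\<exists>y. DERIV \<phi> s :> y \<and> y \<le> 0" by blast
  qed simp
  then show ?thesis by (simp add: \<phi>_def d_def inner_commute)
qed

text \<open>The tangent at \<open>u\<close> bounds \<open>f\<close> from below and the quadratic at
  \<open>v\<close> bounds it from above; \<open>z\<close> is the point where their difference is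
  smallest.\<close>

lemma convex_smooth_interpolation:
  assumes f: "convex_on UNIV f" "L_smooth L f"
  shows "f v \<ge> f u + grad f u \<bullet> (v - u) + (norm (grad f v - grad f u))\<^sup>2 / (2 * L)"
proof -
  define d where "d = grad f v - grad f u"
  define z where "z = v - (1 / L) *\<^sub>R d"
  have L: "L > 0" using f(2) by (simp add: L_smooth_def)
  have "f z \<le> f v + grad f v \<bullet> (z - v) + L / 2 * (norm (z - v))\<^sup>2"
    by (rule smooth_below_quadratic[OF f(2)])
  also have "L / 2 * (norm (z - v))\<^sup>2 = (norm d)\<^sup>2 / (2 * L)"
    using L by (simp add: z_def power_divide power2_eq_square field_simps)
  finally have 1: "f z \<le> f v + grad f v \<bullet> (z - v) + (norm d)\<^sup>2 / (2 * L)" .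
  have 2: "f z \<ge> f u + grad f u \<bullet> (z - u)"
    by (rule convex_smooth_above_tangent[OF f])
  have "grad f u \<bullet> (z - u) - grad f v \<bullet> (z - v) = grad f u \<bullet> (v - u) + (norm d)\<^sup>2 / L"
    by (simp add: z_def d_def algebra_simps power2_norm_eq_inner diff_divide_distrib add_divide_distrib inner_commute)
  with 1 2 have "f v \<ge> f u + grad f u \<bullet> (v - u) + (norm d)\<^sup>2 / L - (norm d)\<^sup>2 / (2 * L)" by linarith
  moreover have "(norm d)\<^sup>2 / L - (norm d)\<^sup>2 / (2 * L) = (norm d)\<^sup>2 / (2 * L)"
    using L by (simp add: field_simps)
  ultimately show ?thesis unfolding d_def by linarith
qed

text \<open>Converse of the interpolation inequality: an envelope with a candidate gradient field
  \<open>G\<close> is recognized as convex and smooth without differentiating it.\<close>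

lemma convex_smoothI:
  fixes h :: "'a::euclidean_space \<Rightarrow> real"
  assumes L: "L > 0"
    and h: "\<And>u v. h v \<ge> h u + G u \<bullet> (v - u) + (norm (G v - G u))\<^sup>2 / (2 * L)"
  shows "convex_on UNIV h" "L_smooth L h" "grad h = G"
proof -
  have lin: "h v \<ge> h u + G u \<bullet> (v - u)" for u v
    using h[of u v] L by (smt (verit) divide_nonneg_pos zero_le_power2)
  have lip: "norm (G v - G u) \<le> L * norm (v - u)" for u v
  proof (cases "G v = G u")
    case False
    have "(norm (G v - G u))\<^sup>2 / L \<le> (G v - G u) \<bullet> (v - u)"
      using h[of u v] h[of v u] L
      by (simp add: norm_minus_commute inner_diff_left inner_diff_right field_simps)
    also have "\<dots> \<le> norm (G v - G u) * norm (v - u)"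
      by (rule norm_cauchy_schwarz)
    finally have "norm (G v - G u) * norm (G v - G u) \<le> norm (G v - G u) * (L * norm (v - u))"
      using L by (simp add: power2_eq_square field_simps)
    then show ?thesis using False by (simp add: mult_le_cancel_left_pos)
  qed (use L in simp)
  \<comment> \<open>Any quadratic remainder identifies the derivative, so \<open>L\<close> may stand
    in place of \<open>L / 2\<close>.\<close>
  have up: "h v \<le> h u + G u \<bullet> (v - u) + L * (norm (v - u))\<^sup>2" for u v
  proof -
    have "h v \<le> h u + G v \<bullet> (v - u)"
      using lin[where u = v and v = u] by (simp add: inner_diff_right)
    also have "G v \<bullet> (v - u) = G u \<bullet> (v - u) + (G v - G u) \<bullet> (v - u)"
      by (simp add: inner_diff_left)
    also have "(G v - G u) \<bullet> (v - u) \<le> norm (G v - G u) * norm (v - u)"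
      by (rule norm_cauchy_schwarz)
    also have "\<dots> \<le> L * norm (v - u) * norm (v - u)"
      by (intro mult_right_mono lip) auto
    finally show ?thesis by (simp add: power2_eq_square mult.assoc)
  qed
  have gd: "GDERIV h u :> G u" for u
    unfolding gderiv_def
  proof (rule has_derivativeI_sandwich[of 1 _ _ _ _ "\<lambda>v. L * norm (v - u)"])
    show "bounded_linear (\<lambda>v. v \<bullet> G u)" by (rule bounded_linear_inner_left)
    show "((\<lambda>v. L * norm (v - u)) \<longlongrightarrow> 0) (at u)"
      by (auto intro!: tendsto_eq_intros)
    fix v assume v: "v \<noteq> u"
    have "\<bar>h v - h u - (v - u) \<bullet> G u\<bar> \<le> L * (norm (v - u))\<^sup>2"
      using lin[of u v] up[of v u] by (simp add: inner_commute)
    then show "norm (h v - h u - (v - u) \<bullet> G u) / norm (v - u) \<le> L * norm (v - u)"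
      using v by (simp add: divide_le_eq power2_eq_square mult.assoc)
  qed simp
  show gr: "grad h = G" using gd grad_eqI by blast
  show "L_smooth L h"
    unfolding L_smooth_def gr
  proof (intro conjI allI L)
    fix u v
    show "h differentiable (at u)" using gd unfolding gderiv_def differentiable_def by blast
    show "norm (G v - G u) \<le> L * norm (u - v)" using lip[of v u] by (simp add: norm_minus_commute)
  qed
  show "convex_on UNIV h"
  proof (rule convex_onI)
    fix t and a b :: 'a assume t: "0 < (t::real)" "t < 1"
    define w where "w = (1 - t) *\<^sub>R a + t *\<^sub>R b"
    have "(1 - t) * (h w + G w \<bullet> (a - w)) + t * (h w + G w \<bullet> (b - w)) \<le> (1 - t) * h a + t * h b"
      using t lin by (intro add_mono mult_left_mono) auto
    moreover have "(1 - t) * (h w + G w \<bullet> (a - w)) + t * (h w + G w \<bullet> (b - w))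
        = h w + G w \<bullet> ((1 - t) *\<^sub>R a + t *\<^sub>R b - w)"
      by (simp add: inner_diff_right inner_add_right algebra_simps)
    ultimately show "h ((1 - t) *\<^sub>R a + t *\<^sub>R b) \<le> (1 - t) * h a + t * h b"
      by (simp add: w_def)
  qed simp
qed

section \<open>Proximal points and Moreau envelopes\<close>

text \<open>First-order optimality when \<open>p\<close> may fail to be differentiable: compare
  \<open>w\<close> with the point at fraction \<open>s\<close> of the segment to \<open>v\<close>
  and divide by \<open>s\<close>; the remaining term is of order \<open>s\<close> and is made
  smaller than \<open>e\<close>.\<close>

lemma prox_optimality:
  fixes p :: "'a::real_inner \<Rightarrow> real"
  assumes p: "convex_on UNIV p" and c: "c \<ge> 0"
    and w: "\<And>v. p w + c / 2 * (norm (w - u))\<^sup>2 \<le> p v + c / 2 * (norm (v - u))\<^sup>2"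
  shows "p v \<ge> p w + c * ((u - w) \<bullet> (v - w))"
proof (rule field_le_epsilon)
  fix e :: real assume e: "e > 0"
  define s where "s = min 1 (e / (c / 2 * (norm (v - w))\<^sup>2 + 1))"
  have den: "c / 2 * (norm (v - w))\<^sup>2 + 1 > 0" using c by (smt (verit) mult_nonneg_nonneg zero_le_power2 divide_nonneg_nonneg)
  have s: "0 < s" "s \<le> 1" using e den by (auto simp: s_def)
  have "s \<le> e / (c / 2 * (norm (v - w))\<^sup>2 + 1)" by (simp add: s_def)
  then have "s * (c / 2 * (norm (v - w))\<^sup>2 + 1) \<le> e"
    using den by (simp only: pos_le_divide_eq)
  then have se: "s * (c / 2 * (norm (v - w))\<^sup>2) \<le> e" using s by (simp add: algebra_simps)
  have "p ((1 - s) *\<^sub>R w + s *\<^sub>R v) \<le> (1 - s) * p w + s * p v"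
    using convex_onD[OF p, of s w v] s by simp
  moreover have "p w + c / 2 * (norm (w - u))\<^sup>2
      \<le> p ((1 - s) *\<^sub>R w + s *\<^sub>R v) + c / 2 * (norm ((1 - s) *\<^sub>R w + s *\<^sub>R v - u))\<^sup>2"
    by (rule w)
  moreover have "(norm ((1 - s) *\<^sub>R w + s *\<^sub>R v - u))\<^sup>2
      = (norm (w - u))\<^sup>2 - 2 * s * ((u - w) \<bullet> (v - w)) + s\<^sup>2 * (norm (v - w))\<^sup>2"
  proof -
    have "(1 - s) *\<^sub>R w + s *\<^sub>R v - u = (w - u) + s *\<^sub>R (v - w)" by (simp add: algebra_simps)
    then show ?thesis
      unfolding power2_norm_eq_inner
      by (simp add: power2_eq_square inner_diff_left inner_diff_right
          inner_add_left inner_add_right inner_commute algebra_simps)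
  qed
  then have "c / 2 * (norm ((1 - s) *\<^sub>R w + s *\<^sub>R v - u))\<^sup>2 = c / 2 * (norm (w - u))\<^sup>2
      - s * (c * ((u - w) \<bullet> (v - w))) + s * (s * (c / 2 * (norm (v - w))\<^sup>2))"
    by (simp add: power2_eq_square[of s] ring_distribs)
  ultimately have "s * (p w + c * ((u - w) \<bullet> (v - w))) \<le> s * (p v + s * (c / 2 * (norm (v - w))\<^sup>2))"
    unfolding distrib_left left_diff_distrib by linarith
  then show "p w + c * ((u - w) \<bullet> (v - w)) \<le> p v + e"
    using s se by (simp add: mult_le_cancel_left_pos)
qed

lemma norm_add_scaleR_sq:
  fixes a b :: "'a::real_inner"
  shows "(norm (a + r *\<^sub>R b))\<^sup>2 = (norm a)\<^sup>2 + 2 * r * (a \<bullet> b) + r\<^sup>2 * (norm b)\<^sup>2"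
  unfolding power2_norm_eq_inner inner_add_left inner_add_right
  by (simp add: inner_commute[of b a] power2_eq_square)

lemma norm_diff_sq:
  fixes a b :: "'a::real_inner"
  shows "(norm (a - b))\<^sup>2 = (norm a)\<^sup>2 - 2 * (a \<bullet> b) + (norm b)\<^sup>2"
  using norm_add_scaleR_sq[of a "-1" b] by simp

text \<open>The quadratic outgrows the affine minorant, so outside the ball of radius
  \<open>R\<close> the objective is at least its value \<open>p u\<close> at the center; compactness
  gives a minimizer inside.\<close>

lemma prox_exists:
  fixes p :: "'a::euclidean_space \<Rightarrow> real"
  assumes p: "convex_on UNIV p" and c: "c > 0" and minorant: "\<And>v. p v \<ge> a + g \<bullet> (v - u)"
  shows "\<exists>w. \<forall>v. p w + c / 2 * (norm (w - u))\<^sup>2 \<le> p v + c / 2 * (norm (v - u))\<^sup>2"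
proof -
  define \<phi> where "\<phi> v = p v + c / 2 * (norm (v - u))\<^sup>2" for v
  define R where "R = 2 * norm g / c + 2 * (p u - a) / c + 1"
  have pu: "p u \<ge> a" using minorant[of u] by simp
  have R: "R \<ge> 1" using pu c by (simp add: R_def)
  have "continuous_on (cball u R) \<phi>"
    unfolding \<phi>_def
    by (intro continuous_intros continuous_on_subset[OF convex_on_continuous[OF open_UNIV p]]) simp
  then obtain w where w: "w \<in> cball u R" "\<And>v. v \<in> cball u R \<Longrightarrow> \<phi> w \<le> \<phi> v"
    using continuous_attains_inf[of "cball u R" \<phi>] R by auto
  have "\<phi> w \<le> \<phi> v" for v
  proof (cases "v \<in> cball u R")
    case False
    define n where "n = norm (v - u)"
    have n: "n \<ge> R" using False by (simp add: n_def dist_norm norm_minus_commute)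
    have "c / 2 * n - norm g \<ge> c / 2 * R - norm g" using n c by simp
    also have "c / 2 * R - norm g = p u - a + c / 2"
      using c by (simp add: R_def field_simps)
    finally have "c / 2 * n - norm g \<ge> p u - a" using c by simp
    then have "1 * (p u - a) \<le> n * (c / 2 * n - norm g)"
      using n R pu by (intro mult_mono) auto
    moreover have "g \<bullet> (v - u) \<ge> - (norm g * n)"
      using norm_cauchy_schwarz[of "- g" "v - u"] by (simp add: n_def)
    ultimately have "\<phi> v \<ge> p u"
      using minorant[of v] by (simp add: \<phi>_def n_def[symmetric] power2_eq_square algebra_simps)
    moreover have "\<phi> w \<le> \<phi> u" using R by (intro w(2)) simp
    ultimately show ?thesis by (simp add: \<phi>_def)
  qed (rule w(2))
  then show ?thesis unfolding \<phi>_def by blast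
qed

text \<open>\<open>prox_optimality\<close> says that \<open>L\<close> times \<open>u - W u\<close>
  is a subgradient of \<open>p\<close> at \<open>W u\<close>. Rewritten in terms of
  \<open>h\<close>, this is exactly the inequality that \<open>convex_smoothI\<close> asks
  for.\<close>

lemma moreau_envelope_smooth:
  fixes p :: "'a::euclidean_space \<Rightarrow> real"
  assumes p: "convex_on UNIV p" and L: "L > 0"
    and W: "\<And>u v. p (W u) + L / 2 * (norm (W u - u))\<^sup>2 \<le> p v + L / 2 * (norm (v - u))\<^sup>2"
    and h: "\<And>u. h u = p (W u) + L / 2 * (norm (W u - u))\<^sup>2"
  shows "convex_on UNIV h" "L_smooth L h" "grad h = (\<lambda>u. L *\<^sub>R (u - W u))"
proof -
  define G where "G u = L *\<^sub>R (u - W u)" for u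
  have ineq: "h v \<ge> h u + G u \<bullet> (v - u) + (norm (G v - G u))\<^sup>2 / (2 * L)" for u v
  proof -
    have "p (W v) \<ge> p (W u) + L * ((u - W u) \<bullet> (W v - W u))"
      using prox_optimality[OF p, of L "W u" u "W v"] W L by simp
    moreover have "L * ((u - W u) \<bullet> (W v - W u)) + L / 2 * (norm (W v - v))\<^sup>2
        = L / 2 * (norm (W u - u))\<^sup>2 + G u \<bullet> (v - u) + (norm (G v - G u))\<^sup>2 / (2 * L)"
    proof -
      define a b where "a = u - W u" and "b = v - W v"
      have e: "W v - W u = (v - u) - (b - a)" "W v - v = - b" "W u - u = - a"
        by (auto simp: a_def b_def)
      have "G v - G u = L *\<^sub>R (b - a)" by (simp add: G_def a_def b_def scaleR_diff_right)
      then have "(norm (G v - G u))\<^sup>2 / (2 * L) = L / 2 * (norm (b - a))\<^sup>2"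
        using L by (simp add: power_mult_distrib power2_eq_square)
      then show ?thesis
        unfolding e G_def a_def[symmetric]
        by (simp add: power2_norm_eq_inner inner_diff_left inner_diff_right inner_commute algebra_simps)
    qed
    ultimately show ?thesis unfolding h by linarith
  qed
  show "convex_on UNIV h" "L_smooth L h" "grad h = (\<lambda>u. L *\<^sub>R (u - W u))"
    using convex_smoothI[OF L ineq] unfolding G_def by auto
qed

text \<open>If \<open>d\<close> were nonzero, a step of \<open>1 / L\<close> along it would lift the
  supporting affine function above the quadratic upper bound.\<close>

lemma subgradient_eq_grad:
  assumes f: "L_smooth L f" and g: "\<And>v. f v \<ge> f u + g \<bullet> (v - u)"
  shows "grad f u = g"
proof -
  have L: "L > 0" using f by (simp add: L_smooth_def)
  define d where "d = g - grad f u"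
  define v where "v = u + (1 / L) *\<^sub>R d"
  have "f u + g \<bullet> (v - u) \<le> f u + grad f u \<bullet> (v - u) + L / 2 * (norm (v - u))\<^sup>2"
    using g[of v] smooth_below_quadratic[OF f, of v u] by linarith
  then have "d \<bullet> (v - u) \<le> L / 2 * (norm (v - u))\<^sup>2" by (simp add: d_def inner_diff_left)
  moreover have "d \<bullet> (v - u) = (norm d)\<^sup>2 / L"
    by (simp add: v_def power2_norm_eq_inner)
  moreover have "(norm (v - u))\<^sup>2 = (norm d)\<^sup>2 / L\<^sup>2"
    by (simp add: v_def power_divide)
  ultimately have "(norm d)\<^sup>2 / L \<le> L / 2 * ((norm d)\<^sup>2 / L\<^sup>2)" by simp
  then have "(norm d)\<^sup>2 \<le> 0" using L by (simp add: field_simps power2_eq_square)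
  then show ?thesis by (simp add: d_def)
qed

subsection \<open>The lowest smooth interpolant\<close>

text \<open>The tangent at \<open>a\<close>, raised by exactly what the Moreau envelope with
  parameter \<open>L\<close> subtracts, so that its envelope is the tangent again.\<close>

definition shifted_cut :: "('a::euclidean_space \<Rightarrow> real) \<Rightarrow> real \<Rightarrow> 'a \<Rightarrow> 'a \<Rightarrow> real" where
  "shifted_cut f L a w = f a + grad f a \<bullet> (w - a) + (norm (grad f a))\<^sup>2 / (2 * L)"

definition cut_max :: "('a::euclidean_space \<Rightarrow> real) \<Rightarrow> real \<Rightarrow> int set \<Rightarrow> (int \<Rightarrow> 'a) \<Rightarrow> 'a \<Rightarrow> real" where
  "cut_max f L J y w = Max ((\<lambda>i. shifted_cut f L (y i) w) ` J)"

lemma cut_max_le_iff: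
  assumes "finite J" "J \<noteq> {}"
  shows "cut_max f L J y w \<le> c \<longleftrightarrow> (\<forall>i\<in>J. shifted_cut f L (y i) w \<le> c)"
  unfolding cut_max_def using assms by simp

lemma shifted_cut_le_cut_max:
  assumes "finite J" "i \<in> J"
  shows "shifted_cut f L (y i) w \<le> cut_max f L J y w"
  unfolding cut_max_def using assms by simp

lemma convex_on_cut_max:
  assumes J: "finite J" "J \<noteq> {}"
  shows "convex_on UNIV (cut_max f L J y)"
proof (rule convex_onI)
  fix t :: real and a b assume t: "0 < t" "t < 1"
  show "cut_max f L J y ((1 - t) *\<^sub>R a + t *\<^sub>R b)
      \<le> (1 - t) * cut_max f L J y a + t * cut_max f L J y b"
    unfolding cut_max_le_iff[OF J]
  proof
    fix i assume i: "i \<in> J"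
    have "shifted_cut f L (y i) ((1 - t) *\<^sub>R a + t *\<^sub>R b)
        = (1 - t) * shifted_cut f L (y i) a + t * shifted_cut f L (y i) b"
    proof -
      define q where "q = (norm (grad f (y i)))\<^sup>2 / (2 * L)"
      show ?thesis unfolding shifted_cut_def q_def[symmetric]
        by (simp add: inner_diff_right inner_add_right algebra_simps)
    qed
    also have "\<dots> \<le> (1 - t) * cut_max f L J y a + t * cut_max f L J y b"
      using t i J by (intro add_mono mult_left_mono shifted_cut_le_cut_max) auto
    finally show "shifted_cut f L (y i) ((1 - t) *\<^sub>R a + t *\<^sub>R b)
        \<le> (1 - t) * cut_max f L J y a + t * cut_max f L J y b" .
  qed
qed simp

text \<open>The gradient step \<open>w u\<close> is the trial point: with its square expanded, the
  interpolation inequality between \<open>y i\<close> and \<open>u\<close> bounds shifted cut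
  \<open>i\<close> at \<open>w u\<close> plus the quadratic. The envelope of \<open>cut_max\<close>
  is thus below every interpolant.\<close>

lemma cut_max_envelope_le:
  assumes g: "convex_on UNIV g" "L_smooth L g"
    and J: "finite J" "J \<noteq> {}"
    and eq: "\<And>i. i \<in> J \<Longrightarrow> g (y i) = f (y i) \<and> grad g (y i) = grad f (y i)"
  defines "w \<equiv> (\<lambda>u. u - (1 / L) *\<^sub>R grad g u)"
  shows "cut_max f L J y (w u) + L / 2 * (norm (w u - u))\<^sup>2 \<le> g u"
proof -
  have L: "L > 0" using g by (simp add: L_smooth_def)
  have "cut_max f L J y (w u) \<le> g u - L / 2 * (norm (w u - u))\<^sup>2"
    unfolding cut_max_le_iff[OF J]
  proof
    fix i assume i: "i \<in> J"
    have "g u \<ge> f (y i) + grad f (y i) \<bullet> (u - y i) + (norm (grad g u - grad f (y i)))\<^sup>2 / (2 * L)"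
      using convex_smooth_interpolation[OF g, where u = "y i" and v = u] eq[OF i] by simp
    moreover have "L / 2 * (norm (w u - u))\<^sup>2 = (norm (grad g u))\<^sup>2 / (2 * L)"
      using L by (simp add: w_def power_divide power2_eq_square)
    moreover have "shifted_cut f L (y i) (w u) + (norm (grad g u))\<^sup>2 / (2 * L)
        = f (y i) + grad f (y i) \<bullet> (u - y i) + (norm (grad g u - grad f (y i)))\<^sup>2 / (2 * L)"
    proof -
      have "grad f (y i) \<bullet> (w u - y i) = grad f (y i) \<bullet> (u - y i) - (grad g u \<bullet> grad f (y i)) / L"
        by (simp add: w_def inner_diff_right inner_commute)
      then show ?thesis
        unfolding shifted_cut_def norm_diff_sq using L by (simp add: field_simps)
    qed
    ultimately show "shifted_cut f L (y i) (w u) \<le> g u - L / 2 * (norm (w u - u))\<^sup>2" by linarith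
  qed
  then show ?thesis by simp
qed

text \<open>
  Subtracting the quadratic from the conjugates turns lowest smooth interpolation into a convex
  hull of finitely many points; dually, the lowest interpolant is the infimal convolution of the
  maximum of the shifted cuts with the quadratic.
\<close>

lemma lower_model_envelope:
  assumes f: "convex_on UNIV f" "L_smooth L f" and J: "finite J" "J \<noteq> {}"
  shows "interpolant f L J y (lower_model f L J y)"
    and "\<And>g u. interpolant f L J y g \<Longrightarrow> lower_model f L J y u \<le> g u"
    and "\<And>u v. lower_model f L J y u \<le> cut_max f L J y v + L / 2 * (norm (v - u))\<^sup>2"
    and "\<And>u. \<exists>w. lower_model f L J y u = cut_max f L J y w + L / 2 * (norm (w - u))\<^sup>2"
proof -
  let ?p = "cut_max f L J y"
  have L: "L > 0" using f by (simp add: L_smooth_def)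
  have p: "convex_on UNIV ?p" by (rule convex_on_cut_max[OF J])
  have "\<exists>w. \<forall>v. ?p w + L / 2 * (norm (w - u))\<^sup>2 \<le> ?p v + L / 2 * (norm (v - u))\<^sup>2" for u
  proof -
    obtain i where i: "i \<in> J" using J by blast
    have "?p v \<ge> shifted_cut f L (y i) u + grad f (y i) \<bullet> (v - u)" for v
    proof -
      have "shifted_cut f L (y i) v = shifted_cut f L (y i) u + grad f (y i) \<bullet> (v - u)"
        by (simp add: shifted_cut_def inner_diff_right)
      then show ?thesis using shifted_cut_le_cut_max[OF J(1) i, of f L y v] by simp
    qed
    then show ?thesis by (rule prox_exists[OF p L])
  qed
  then obtain W where W: "\<And>u v. ?p (W u) + L / 2 * (norm (W u - u))\<^sup>2 \<le> ?p v + L / 2 * (norm (v - u))\<^sup>2"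
    by metis
  define h where "h u = ?p (W u) + L / 2 * (norm (W u - u))\<^sup>2" for u
  have h: "convex_on UNIV h" "L_smooth L h"
    using moreau_envelope_smooth[OF p L W h_def] by auto
  have below: "h u \<le> g u" if "interpolant f L J y g" for g u
  proof -
    have "h u \<le> ?p (u - (1 / L) *\<^sub>R grad g u) + L / 2 * (norm (u - (1 / L) *\<^sub>R grad g u - u))\<^sup>2"
      unfolding h_def by (rule W)
    also have "\<dots> \<le> g u"
      using that J unfolding interpolant_def by (intro cut_max_envelope_le) auto
    finally show ?thesis .
  qed
  have "interpolant f L J y f" using f by (simp add: interpolant_def)
  note hf = below[OF this]
  have "interpolant f L J y h"
    unfolding interpolant_def
  proof (intro conjI h ballI)
    fix i assume i: "i \<in> J"
    let ?g = "grad f (y i)"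
    let ?d = "W (y i) - y i"
    \<comment> \<open>Completing the square: cut \<open>i\<close> alone keeps the envelope at
      \<open>y i\<close> from falling below \<open>f (y i)\<close>.\<close>
    have "0 \<le> L / 2 * (norm (?d + (1 / L) *\<^sub>R ?g))\<^sup>2" using L by simp
    also have "\<dots> = ?g \<bullet> ?d + (norm ?g)\<^sup>2 / (2 * L) + L / 2 * (norm ?d)\<^sup>2"
      using L unfolding norm_add_scaleR_sq
      by (simp add: inner_commute[of ?g ?d] power2_eq_square field_simps)
    finally have "f (y i) \<le> shifted_cut f L (y i) (W (y i)) + L / 2 * (norm ?d)\<^sup>2"
      by (simp add: shifted_cut_def)
    also have "\<dots> \<le> h (y i)"
      unfolding h_def using shifted_cut_le_cut_max[OF J(1) i, of f L y "W (y i)"] by simp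
    finally show e: "h (y i) = f (y i)" using hf[of "y i"] by simp
    have "f v \<ge> f (y i) + grad h (y i) \<bullet> (v - y i)" for v
      using convex_smooth_above_tangent[OF h, of "y i" v] hf[of v] e by simp
    then show "grad h (y i) = ?g" using subgradient_eq_grad[OF f(2)] by metis
  qed
  then have eq: "lower_model f L J y = h"
    unfolding lower_model_def by (intro Least_equality[where P = "interpolant f L J y"]) (auto simp: le_fun_def below)
  show "interpolant f L J y (lower_model f L J y)" unfolding eq by fact
  show "\<And>g u. interpolant f L J y g \<Longrightarrow> lower_model f L J y u \<le> g u" unfolding eq by (rule below)
  show "\<And>u v. lower_model f L J y u \<le> ?p v + L / 2 * (norm (v - u))\<^sup>2"
    unfolding eq h_def by (rule W)
  show "\<And>u. \<exists>w. lower_model f L J y u = ?p w + L / 2 * (norm (w - u))\<^sup>2"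
    unfolding eq h_def by blast
qed

section \<open>The quadratic program as a proximal step on the model\<close>

text \<open>Expanding the square turns constraint \<open>i\<close> into a bound on shifted cut
  \<open>i\<close> at \<open>w u c\<close>. This point makes \<open>L\<close> times
  \<open>w u c - u\<close> equal to \<open>\<rho>\<close> times \<open>u - c\<close>, the
  stationarity condition in \<open>u\<close> when the envelope variable is held fixed.\<close>

lemma qp_feasible_iff:
  assumes "\<rho> > 0" "L > 0" "finite J" "J \<noteq> {}"
  defines "w \<equiv> \<lambda>u c. u + (\<rho> / L) *\<^sub>R (u - c)"
  shows "qp_feasible f L \<rho> J y c (s, u) \<longleftrightarrow>
    cut_max f L J y (w u c) + L / 2 * (norm (w u c - u))\<^sup>2 \<le> s"
proof -
  have id: "f a + grad f a \<bullet> (u - a) + \<rho>\<^sup>2 / (2 * L) * (norm (u - c + (1 / \<rho>) *\<^sub>R grad f a))\<^sup>2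
      = shifted_cut f L a (w u c) + L / 2 * (norm (w u c - u))\<^sup>2" for a
  proof -
    define e where "e = u - c"
    have "\<rho>\<^sup>2 / (2 * L) * (norm (e + (1 / \<rho>) *\<^sub>R grad f a))\<^sup>2
        = \<rho>\<^sup>2 / (2 * L) * (norm e)\<^sup>2 + \<rho> / L * (grad f a \<bullet> e) + (norm (grad f a))\<^sup>2 / (2 * L)"
      using assms(1,2) unfolding norm_add_scaleR_sq
      by (simp add: inner_commute[of e "grad f a"] power2_eq_square field_simps)
    moreover have "L / 2 * (norm (w u c - u))\<^sup>2 = \<rho>\<^sup>2 / (2 * L) * (norm e)\<^sup>2"
      using assms(1,2) by (simp add: w_def e_def[symmetric] power_mult_distrib power2_eq_square)
    moreover have "grad f a \<bullet> (w u c - a) = grad f a \<bullet> (u - a) + \<rho> / L * (grad f a \<bullet> e)"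
      by (simp add: w_def e_def[symmetric] inner_diff_right inner_add_right)
    ultimately show ?thesis unfolding shifted_cut_def e_def by simp
  qed
  have "(\<rho>\<^sup>2 / (2 * L) * (norm (u - c + (1 / \<rho>) *\<^sub>R grad f (y i)))\<^sup>2
        \<le> s - f (y i) - grad f (y i) \<bullet> (u - y i)) \<longleftrightarrow>
      shifted_cut f L (y i) (w u c) \<le> s - L / 2 * (norm (w u c - u))\<^sup>2" for i
    using id[of "y i"] by linarith
  then have "qp_feasible f L \<rho> J y c (s, u) \<longleftrightarrow>
      cut_max f L J y (w u c) \<le> s - L / 2 * (norm (w u c - u))\<^sup>2"
    unfolding cut_max_le_iff[OF assms(3,4)] qp_feasible_def by simp
  then show ?thesis by linarith
qed

text \<open>The program minimizes over coupled pairs of \<open>w\<close> and \<open>u\<close> only.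
  This costs nothing, because the best \<open>u\<close> for a given \<open>w\<close> is coupled to
  it. Hence \<open>u\<close> minimizes the model plus the proximal term, and the claim is the
  first-order condition.\<close>

lemma qp_solution_model_prox:
  assumes f: "convex_on UNIV f" "L_smooth L f" and J: "finite J" "J \<noteq> {}" and \<rho>: "\<rho> > 0"
    and sol: "qp_solution f L \<rho> J y c (s, u)"
  shows "lower_model f L J y v \<ge> lower_model f L J y u + \<rho> * ((c - u) \<bullet> (v - u))"
proof (rule prox_optimality)
  let ?h = "lower_model f L J y" and ?p = "cut_max f L J y"
  have L: "L > 0" using f by (simp add: L_smooth_def)
  note model = lower_model_envelope[OF f J, of y]
  show "convex_on UNIV ?h" using model(1) by (simp add: interpolant_def)
  show "\<rho> \<ge> 0" using \<rho> by simp
  have feas: "qp_feasible f L \<rho> J y c (s, u)"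
    and opt: "\<And>s' u'. qp_feasible f L \<rho> J y c (s', u') \<Longrightarrow>
      s + \<rho> / 2 * (norm (u - c))\<^sup>2 \<le> s' + \<rho> / 2 * (norm (u' - c))\<^sup>2"
    using sol unfolding qp_solution_def is_arg_min_linorder by auto
  fix v
  obtain w where w: "?h v = ?p w + L / 2 * (norm (w - v))\<^sup>2" using model(4) by blast
  \<comment> \<open>For this \<open>w\<close>, the minimizer \<open>u'\<close> of \<open>L / 2 * norm (w - _)\<^sup>2 + \<rho> / 2 * norm (_ - c)\<^sup>2\<close> meets the coupling of the quadratic program.\<close>
  define u' where "u' = (1 / (L + \<rho>)) *\<^sub>R (L *\<^sub>R w + \<rho> *\<^sub>R c)"
  have "(L + \<rho>) *\<^sub>R u' = L *\<^sub>R w + \<rho> *\<^sub>R c" using L \<rho> by (simp add: u'_def)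
  then have bal: "L *\<^sub>R (w - u') = \<rho> *\<^sub>R (u' - c)" by (simp add: algebra_simps)
  then have "(1 / L) *\<^sub>R (L *\<^sub>R (w - u')) = (1 / L) *\<^sub>R (\<rho> *\<^sub>R (u' - c))" by simp
  then have "w - u' = (\<rho> / L) *\<^sub>R (u' - c)" using L by simp
  then have w': "u' + (\<rho> / L) *\<^sub>R (u' - c) = w" by (simp add: algebra_simps)
  have "?h u \<le> s"
    using feas model(3)[of u] unfolding qp_feasible_iff[OF \<rho> L J] by (blast intro: order_trans)
  then have "?h u + \<rho> / 2 * (norm (u - c))\<^sup>2 \<le> s + \<rho> / 2 * (norm (u - c))\<^sup>2" by simp
  also have "\<dots> \<le> ?p w + L / 2 * (norm (w - u'))\<^sup>2 + \<rho> / 2 * (norm (u' - c))\<^sup>2"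
    by (rule opt) (simp add: qp_feasible_iff[OF \<rho> L J] w')
  \<comment> \<open>Expanded around \<open>u'\<close>, the linear terms cancel by
    \<open>bal\<close>.\<close>
  also have "\<dots> \<le> ?p w + L / 2 * (norm (w - v))\<^sup>2 + \<rho> / 2 * (norm (v - c))\<^sup>2"
  proof -
    define e where "e = v - u'"
    have X: "L * ((w - u') \<bullet> e) = \<rho> * ((u' - c) \<bullet> e)" using arg_cong[OF bal, of "\<lambda>z. z \<bullet> e"] by simp
    have A: "(norm (w - v))\<^sup>2 = (norm (w - u'))\<^sup>2 - 2 * ((w - u') \<bullet> e) + (norm e)\<^sup>2"
    proof -
      have "w - v = (w - u') - e" by (simp add: e_def)
      then show ?thesis by (simp only: norm_diff_sq[of _ e])
    qed
    have B: "(norm (v - c))\<^sup>2 = (norm (u' - c))\<^sup>2 + 2 * ((u' - c) \<bullet> e) + (norm e)\<^sup>2"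
    proof -
      have "v - c = (u' - c) + 1 *\<^sub>R e" by (simp add: e_def)
      then show ?thesis by (simp only: norm_add_scaleR_sq) simp
    qed
    have "L / 2 * (norm e)\<^sup>2 + \<rho> / 2 * (norm e)\<^sup>2 \<ge> 0" using L \<rho> by auto
    moreover have "L / 2 * (2 * ((w - u') \<bullet> e)) = \<rho> / 2 * (2 * ((u' - c) \<bullet> e))" using X by simp
    ultimately show ?thesis unfolding A B distrib_left right_diff_distrib by linarith
  qed
  finally show "?h u + \<rho> / 2 * (norm (u - c))\<^sup>2 \<le> ?h v + \<rho> / 2 * (norm (v - c))\<^sup>2"
    unfolding w .
qed

text \<open>\<open>w\<close> is the convex combination of \<open>u\<close> and \<open>v\<close> with
  weights \<open>1 / s\<close> and \<open>1 - 1 / s\<close>.\<close>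

lemma norm_weighted_mean_le:
  fixes u v w c :: "'a::real_normed_vector"
  assumes "s \<ge> 1" "s *\<^sub>R w = u + (s - 1) *\<^sub>R v" "norm (u - c) \<le> D" "norm (v - c) \<le> D"
  shows "norm (w - c) \<le> D"
proof -
  have "s *\<^sub>R (w - c) = (u - c) + (s - 1) *\<^sub>R (v - c)" using assms(2) by (simp add: algebra_simps)
  then have "norm (s *\<^sub>R (w - c)) \<le> norm (u - c) + norm ((s - 1) *\<^sub>R (v - c))"
    by (metis norm_triangle_ineq)
  then have "s * norm (w - c) \<le> norm (u - c) + (s - 1) * norm (v - c)" using assms(1) by simp
  also have "\<dots> \<le> D + (s - 1) * D" using assms by (intro add_mono mult_left_mono) auto
  finally have "s * norm (w - c) \<le> s * D" by (simp add: algebra_simps)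
  then show ?thesis using assms(1) by simp
qed

subsection \<open>Runs of the accelerated proximal bundle method\<close>

locale accelerated_bundle =
  fixes f :: "'a::euclidean_space \<Rightarrow> real" and L \<rho> :: real and xstar :: 'a
    and I :: "nat \<Rightarrow> int set" and y :: "int \<Rightarrow> 'a" and x \<zeta> :: "nat \<Rightarrow> 'a" and t :: "nat \<Rightarrow> real"
  assumes convex: "convex_on UNIV f" and smooth: "L_smooth L f"
    and minimizer: "\<And>u. f xstar \<le> f u" and \<rho>_pos: "\<rho> > 0"
    and run: "a_PBM f L \<rho> I y x \<zeta> t"
begin

abbreviation "serious \<equiv> serious_iteration L \<rho> y x"
abbreviation "model k \<equiv> lower_model f L (I k) y"

lemma L_pos: "L > 0"
  using smooth by (simp add: L_smooth_def)

lemma I_Suc: "I (Suc k) = insert (int (Suc k)) (I k)"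
proof -
  have "I (Suc k) = I k \<union> {int k + 1}" using run unfolding a_PBM_def by blast
  then show ?thesis by (simp add: add.commute)
qed

lemma finite_I: "finite (I k)"
  using run by (induction k) (auto simp: I_Suc a_PBM_def)

lemma zero_in_I: "0 \<in> I k"
  using run by (induction k) (auto simp: I_Suc a_PBM_def)

lemma last_in_I: "int k \<in> I k"
  using zero_in_I by (cases k) (auto simp: I_Suc)

lemma qp_step: "\<exists>s. qp_solution f L \<rho> (I k) y (x k) (s, y (int (Suc k)))"
proof -
  have "\<exists>s. qp_solution f L \<rho> (I k) y (x k) (s, y (int k + 1))"
    using run unfolding a_PBM_def by blast
  then show ?thesis by (simp add: add.commute)
qed

lemma serious_iff: "serious k \<longleftrightarrow>
    step_const L \<rho> * norm (y (int (Suc k)) - y (int k)) \<le> norm (x k - y (int (Suc k)))"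
  by (simp add: serious_iteration_def add.commute)

lemma serious_update:
  assumes "serious k"
  shows "t (Suc k) = (1 + sqrt (1 + 4 * (t k)\<^sup>2)) / 2"
    and "\<zeta> (Suc k) = x k - (1 / \<rho>) *\<^sub>R grad f (y (int (Suc k)))"
    and "x (Suc k) = \<zeta> (Suc k) + ((t k - 1) / t (Suc k)) *\<^sub>R (\<zeta> (Suc k) - \<zeta> k)"
proof -
  have "t (Suc k) = (1 + sqrt (1 + 4 * (t k)\<^sup>2)) / 2 \<and>
      \<zeta> (Suc k) = x k - (1 / \<rho>) *\<^sub>R grad f (y (int k + 1)) \<and>
      x (Suc k) = \<zeta> (Suc k) + ((t k - 1) / t (Suc k)) *\<^sub>R (\<zeta> (Suc k) - \<zeta> k)"
    using run assms unfolding a_PBM_def by metis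
  then show "t (Suc k) = (1 + sqrt (1 + 4 * (t k)\<^sup>2)) / 2"
    and "\<zeta> (Suc k) = x k - (1 / \<rho>) *\<^sub>R grad f (y (int (Suc k)))"
    and "x (Suc k) = \<zeta> (Suc k) + ((t k - 1) / t (Suc k)) *\<^sub>R (\<zeta> (Suc k) - \<zeta> k)"
    by (simp_all add: add.commute)
qed

lemma null_update:
  assumes "\<not> serious k"
  shows "x (Suc k) = x k" "\<zeta> (Suc k) = \<zeta> k" "t (Suc k) = t k"
  using run assms unfolding a_PBM_def by metis+

section \<open>Properties of the successive models\<close>

lemma model_interpolant: "interpolant f L (I k) y (model k)"
  using lower_model_envelope(1)[OF convex smooth finite_I] zero_in_I by blast

lemma model_least: "interpolant f L (I k) y g \<Longrightarrow> model k u \<le> g u"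
  using lower_model_envelope(2)[OF convex smooth finite_I] zero_in_I by blast

lemma model_smooth: "convex_on UNIV (model k)" "L_smooth L (model k)"
  using model_interpolant by (auto simp: interpolant_def)

lemma model_cut: "i \<in> I k \<Longrightarrow> model k (y i) = f (y i)" "i \<in> I k \<Longrightarrow> grad (model k) (y i) = grad f (y i)"
  using model_interpolant by (auto simp: interpolant_def)

lemma model_le: "model k u \<le> f u"
  by (rule model_least) (simp add: interpolant_def convex smooth)

text \<open>The later model meets all conditions of \<open>I k\<close>, so it competes in the
  minimum that defines \<open>model k\<close>.\<close>

lemma model_mono: "model k u \<le> model (Suc k) u"
  using model_interpolant[of "Suc k"] by (intro model_least) (auto simp: interpolant_def I_Suc)

lemma model_above_tangent:
  assumes "i \<in> I k"
  shows "model k u \<ge> f (y i) + grad f (y i) \<bullet> (u - y i)"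
  using convex_smooth_above_tangent[OF model_smooth, of k "y i" u] model_cut[OF assms] by simp

lemma model_subgradient:
  "model k v \<ge> model k (y (int (Suc k))) + \<rho> * ((x k - y (int (Suc k))) \<bullet> (v - y (int (Suc k))))"
  using qp_step qp_solution_model_prox[OF convex smooth finite_I _ \<rho>_pos] zero_in_I by blast

lemma model_growth:
  "model k v + \<rho> / 2 * (norm (v - x k))\<^sup>2 \<ge> model k (y (int (Suc k)))
     + \<rho> / 2 * (norm (y (int (Suc k)) - x k))\<^sup>2 + \<rho> / 2 * (norm (v - y (int (Suc k))))\<^sup>2"
proof -
  let ?Y = "y (int (Suc k))"
  have "v - x k = (v - ?Y) - (x k - ?Y)" by simp
  then have "(norm (v - x k))\<^sup>2 = (norm (v - ?Y))\<^sup>2 - 2 * ((x k - ?Y) \<bullet> (v - ?Y)) + (norm (?Y - x k))\<^sup>2"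
    by (simp only: norm_diff_sq inner_commute norm_minus_commute)
  then have "\<rho> / 2 * (norm (v - x k))\<^sup>2 = \<rho> / 2 * (norm (v - ?Y))\<^sup>2
      - \<rho> * ((x k - ?Y) \<bullet> (v - ?Y)) + \<rho> / 2 * (norm (?Y - x k))\<^sup>2"
    by (simp add: ring_distribs)
  then show ?thesis using model_subgradient[of k v] by linarith
qed

text \<open>Index \<open>k\<close> is already a cut at iteration \<open>k\<close>: the model lies
  above the tangent of \<open>f\<close> at \<open>y (int k)\<close>, and smoothness keeps
  \<open>f\<close> within a quadratic of that tangent.\<close>

lemma model_error:
  "f (y (int (Suc k))) - model k (y (int (Suc k))) \<le> L / 2 * (norm (y (int (Suc k)) - y (int k)))\<^sup>2"
  using smooth_below_quadratic[OF smooth, of "y (int (Suc k))" "y (int k)"]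
    model_above_tangent[OF last_in_I, of k "y (int (Suc k))"] by linarith

section \<open>Serious steps as inexact proximal gradient steps\<close>

text \<open>The gradients of \<open>f\<close> and the model agree at \<open>y (int k)\<close> and
  are Lipschitz, so at the new point they differ by at most \<open>2 * L * d\<close>. There they are
  \<open>\<rho>\<close> times \<open>x k - \<zeta> (Suc k)\<close> and \<open>x k - ?Y\<close>, so
  this bounds \<open>e\<close>, while the test bounds \<open>d\<close>.\<close>

lemma serious_error:
  assumes "serious k"
  shows "L * (norm (\<zeta> (Suc k) - y (int (Suc k))))\<^sup>2 \<le> \<rho> / 2 * (norm (x k - \<zeta> (Suc k)))\<^sup>2"
proof -
  let ?Y = "y (int (Suc k))"
  define q where "q = sqrt (2 * L / \<rho>)"
  define e where "e = norm (\<zeta> (Suc k) - ?Y)"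
  define d where "d = norm (?Y - y (int k))"
  have q: "q > 0" "q\<^sup>2 = 2 * L / \<rho>" using L_pos \<rho>_pos by (auto simp: q_def)
  have g: "grad (model k) ?Y = \<rho> *\<^sub>R (x k - ?Y)"
    using model_subgradient by (intro subgradient_eq_grad[OF model_smooth(2)]) simp
  have lip: "norm (grad h ?Y - grad h (y (int k))) \<le> L * d" if "L_smooth L h" for h :: "'a \<Rightarrow> real"
    using that unfolding L_smooth_def d_def by (metis norm_minus_commute)
  have "norm (grad (model k) ?Y - grad f ?Y)
      = norm ((grad (model k) ?Y - grad (model k) (y (int k))) - (grad f ?Y - grad f (y (int k))))"
    using model_cut(2)[OF last_in_I] by simp
  also have "\<dots> \<le> L * d + L * d"
    by (intro norm_triangle_le_diff add_mono lip model_smooth smooth)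
  finally have "norm (\<rho> *\<^sub>R (x k - ?Y) - grad f ?Y) \<le> 2 * L * d" unfolding g by simp
  moreover have "\<rho> *\<^sub>R (x k - ?Y) - grad f ?Y = \<rho> *\<^sub>R (\<zeta> (Suc k) - ?Y)"
    using \<rho>_pos by (simp add: serious_update(2)[OF assms] algebra_simps)
  ultimately have "\<rho> * e \<le> 2 * L * d" using \<rho>_pos by (simp add: e_def)
  then have "e \<le> 2 * L / \<rho> * d" using \<rho>_pos by (simp add: field_simps)
  then have "(q + 1) * e \<le> (q + 1) * (2 * L / \<rho> * d)" using q by (intro mult_left_mono) auto
  also have "\<dots> \<le> norm (x k - ?Y)"
    using assms unfolding serious_iff step_const_def d_def q_def by (simp only: mult_ac)
  \<comment> \<open>The summand 1 in \<open>step_const\<close> pays for replacing \<open>?Y\<close>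
    by \<open>\<zeta> (Suc k)\<close>; the factor \<open>q\<close> survives.\<close>
  also have "\<dots> \<le> norm (x k - \<zeta> (Suc k)) + e"
    unfolding e_def using norm_triangle_ineq[of "x k - \<zeta> (Suc k)" "\<zeta> (Suc k) - ?Y"] by simp
  finally have "q * e \<le> norm (x k - \<zeta> (Suc k))" by (simp add: algebra_simps)
  then have "(q * e)\<^sup>2 \<le> (norm (x k - \<zeta> (Suc k)))\<^sup>2"
    using q by (intro power_mono) (auto simp: e_def)
  then show ?thesis
    using \<rho>_pos by (simp add: power_mult_distrib q(2) e_def field_simps)
qed

text \<open>Smoothness and convexity are both used at \<open>?Y\<close>, whose gradient is
  \<open>\<rho>\<close> times \<open>p\<close>. By \<open>serious_error\<close> the smoothness term
  costs a quarter of \<open>\<rho> * (norm p)\<^sup>2\<close>, leaving three quarters against the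
  claimed half.\<close>

lemma serious_descent:
  assumes "serious k"
  shows "f (\<zeta> (Suc k)) - f u \<le>
    \<rho> * ((x k - \<zeta> (Suc k)) \<bullet> (x k - u)) - \<rho> / 2 * (norm (x k - \<zeta> (Suc k)))\<^sup>2"
proof -
  let ?Y = "y (int (Suc k))"
  define p where "p = x k - \<zeta> (Suc k)"
  have g: "grad f ?Y = \<rho> *\<^sub>R p"
    using \<rho>_pos by (simp add: serious_update(2)[OF assms] p_def)
  have "f (\<zeta> (Suc k)) \<le> f ?Y + \<rho> * (p \<bullet> (\<zeta> (Suc k) - ?Y)) + L / 2 * (norm (\<zeta> (Suc k) - ?Y))\<^sup>2"
    using smooth_below_quadratic[OF smooth, of "\<zeta> (Suc k)" ?Y] unfolding g inner_scaleR_left .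
  moreover have "f u \<ge> f ?Y + \<rho> * (p \<bullet> (u - ?Y))"
    using convex_smooth_above_tangent[OF convex smooth, of ?Y u] unfolding g inner_scaleR_left .
  moreover have "L * (norm (\<zeta> (Suc k) - ?Y))\<^sup>2 \<le> \<rho> / 2 * (norm p)\<^sup>2"
    using serious_error[OF assms] by (simp add: p_def)
  moreover have "\<rho> * (p \<bullet> (\<zeta> (Suc k) - ?Y)) - \<rho> * (p \<bullet> (u - ?Y)) = \<rho> * (p \<bullet> (x k - u)) - \<rho> * (norm p)\<^sup>2"
  proof -
    have "p \<bullet> (\<zeta> (Suc k) - ?Y) - p \<bullet> (u - ?Y) = p \<bullet> (x k - u) - p \<bullet> p"
      by (simp add: inner_diff_right) (simp add: p_def inner_diff_right)
    then show ?thesis by (simp add: power2_norm_eq_inner flip: right_diff_distrib)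
  qed
  moreover have "\<rho> * (norm p)\<^sup>2 \<ge> 0" using \<rho>_pos by simp
  ultimately show ?thesis unfolding p_def[symmetric] by linarith
qed

section \<open>Momentum parameter and energy\<close>

lemma t_ge_1: "t k \<ge> 1"
proof (induction k)
  case 0
  then show ?case using run by (simp add: a_PBM_def)
next
  case (Suc k)
  then show ?case
  proof (cases "serious k")
    case True
    define r where "r = sqrt (1 + 4 * (t k)\<^sup>2)"
    have "r \<ge> 1" by (simp add: r_def)
    then show ?thesis using serious_update(1)[OF True] by (simp add: r_def[symmetric])
  qed (simp add: null_update)
qed

text \<open>The identity matches the energy weights of consecutive indices; the growth turns a count
  of serious iterations into a lower bound on \<open>t\<close>.\<close>

lemma t_serious:
  assumes "serious k"
  shows "(t (Suc k))\<^sup>2 - t (Suc k) = (t k)\<^sup>2" "t (Suc k) \<ge> t k + 1 / 2"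
proof -
  define r where "r = sqrt (1 + 4 * (t k)\<^sup>2)"
  have e: "t (Suc k) = (1 + r) / 2" using serious_update(1)[OF assms] by (simp add: r_def)
  have "r\<^sup>2 = 1 + 4 * (t k)\<^sup>2" by (simp add: r_def)
  then show "(t (Suc k))\<^sup>2 - t (Suc k) = (t k)\<^sup>2" unfolding e by (simp add: field_simps power2_eq_square)
  have "2 * t k \<le> r" unfolding r_def using t_ge_1[of k] by (intro real_le_rsqrt) (simp add: power_mult_distrib)
  then show "t (Suc k) \<ge> t k + 1 / 2" unfolding e by simp
qed

lemma t_mono: "i \<le> j \<Longrightarrow> t i \<le> t j"
proof (rule lift_Suc_mono_le)
  fix k show "t k \<le> t (Suc k)"
    using t_serious(2)[of k] null_update(3)[of k] by (cases "serious k") auto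
qed

text \<open>The auxiliary sequence of Nesterov's method: \<open>x k\<close> averages
  \<open>momentum k\<close> and \<open>\<zeta> k\<close> with weights \<open>1 / t k\<close> and
  \<open>1 - 1 / t k\<close>.\<close>

definition momentum :: "nat \<Rightarrow> 'a" where
  "momentum k = t k *\<^sub>R x k - (t k - 1) *\<^sub>R \<zeta> k"

text \<open>After a serious iteration the weight is the square of the previous \<open>t\<close>. In
  this form it vanishes at the start and is unchanged by null steps.\<close>

definition energy :: "nat \<Rightarrow> real" where
  "energy k = ((t k)\<^sup>2 - t k) * (f (\<zeta> k) - f xstar) + \<rho> / 2 * (norm (momentum k - xstar))\<^sup>2"

lemma momentum_serious:
  assumes "serious k"
  shows "momentum (Suc k) = t k *\<^sub>R \<zeta> (Suc k) - (t k - 1) *\<^sub>R \<zeta> k"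
proof -
  have e: "t (Suc k) *\<^sub>R x (Suc k) = t (Suc k) *\<^sub>R \<zeta> (Suc k) + (t k - 1) *\<^sub>R (\<zeta> (Suc k) - \<zeta> k)"
    using t_ge_1[of "Suc k"] by (simp add: serious_update(3)[OF assms] scaleR_add_right)
  show ?thesis unfolding momentum_def e by (simp add: algebra_simps)
qed

text \<open>\<open>serious_descent\<close> is taken at \<open>\<zeta> k\<close> with weight
  \<open>T - 1\<close> and at \<open>xstar\<close> with weight 1. Multiplied by \<open>T\<close>,
  the right-hand side is exactly the decrease of the momentum term.\<close>

lemma energy_Suc: "energy (Suc k) \<le> energy k"
proof (cases "serious k")
  case True
  define a where "a = x k - \<zeta> (Suc k)"
  define m where "m = momentum k - xstar"
  define T where "T = t k"
  define \<delta> where "\<delta> = f (\<zeta> k) - f xstar"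
  define \<delta>' where "\<delta>' = f (\<zeta> (Suc k)) - f xstar"
  have T: "T \<ge> 1" using t_ge_1 by (simp add: T_def)
  have m: "m = (T - 1) *\<^sub>R (x k - \<zeta> k) + (x k - xstar)"
    by (simp add: m_def momentum_def T_def algebra_simps)
  have m': "momentum (Suc k) - xstar = m - T *\<^sub>R a"
    unfolding momentum_serious[OF True] by (simp add: m_def momentum_def a_def T_def algebra_simps)
  have "(T - 1) * (\<delta>' - \<delta>) + \<delta>' \<le> (T - 1) * (\<rho> * (a \<bullet> (x k - \<zeta> k)) - \<rho> / 2 * (norm a)\<^sup>2)
      + (\<rho> * (a \<bullet> (x k - xstar)) - \<rho> / 2 * (norm a)\<^sup>2)"
    using serious_descent[OF True, of "\<zeta> k"] serious_descent[OF True, of xstar] T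
    by (intro add_mono mult_left_mono) (auto simp: a_def \<delta>_def \<delta>'_def)
  also have "\<dots> = \<rho> * (a \<bullet> m) - T * (\<rho> / 2 * (norm a)\<^sup>2)"
  proof -
    define P where "P = \<rho> / 2 * (norm a)\<^sup>2"
    show ?thesis
      unfolding m inner_add_right inner_scaleR_right P_def[symmetric] by (simp add: algebra_simps)
  qed
  finally have "T * ((T - 1) * (\<delta>' - \<delta>) + \<delta>') \<le> T * (\<rho> * (a \<bullet> m) - T * (\<rho> / 2 * (norm a)\<^sup>2))"
    using T by (intro mult_left_mono) auto
  moreover have "\<rho> / 2 * (norm (m - T *\<^sub>R a))\<^sup>2
      = \<rho> / 2 * (norm m)\<^sup>2 - T * (\<rho> * (a \<bullet> m) - T * (\<rho> / 2 * (norm a)\<^sup>2))"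
    unfolding norm_diff_sq by (simp add: power_mult_distrib power2_eq_square inner_commute algebra_simps)
  moreover have "energy (Suc k) = T\<^sup>2 * \<delta>' + \<rho> / 2 * (norm (m - T *\<^sub>R a))\<^sup>2"
    unfolding energy_def t_serious(1)[OF True] m' by (simp add: T_def \<delta>'_def)
  moreover have "energy k = (T\<^sup>2 - T) * \<delta> + \<rho> / 2 * (norm m)\<^sup>2"
    by (simp add: energy_def T_def \<delta>_def m_def)
  moreover have "T * ((T - 1) * (\<delta>' - \<delta>) + \<delta>') = T\<^sup>2 * \<delta>' - (T\<^sup>2 - T) * \<delta>"
    by (simp add: power2_eq_square algebra_simps)
  ultimately show ?thesis by linarith
qed (simp add: energy_def momentum_def null_update)

lemma energy_le: "energy k \<le> \<rho> / 2 * (norm (x 0 - xstar))\<^sup>2"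
proof (induction k)
  case 0
  then show ?case using run by (simp add: energy_def momentum_def a_PBM_def)
next
  case (Suc k)
  then show ?case using energy_Suc[of k] by linarith
qed

section \<open>Uniform bounds on the iterates\<close>

lemma t_sq_ge: "(t k)\<^sup>2 - t k \<ge> 0"
  using t_ge_1[of k] by (simp add: power2_eq_square)

lemma momentum_bound: "norm (momentum k - xstar) \<le> norm (x 0 - xstar)"
proof -
  have "((t k)\<^sup>2 - t k) * (f (\<zeta> k) - f xstar) \<ge> 0" using t_sq_ge minimizer by simp
  then have "\<rho> / 2 * (norm (momentum k - xstar))\<^sup>2 \<le> \<rho> / 2 * (norm (x 0 - xstar))\<^sup>2"
    using energy_le[of k] by (simp add: energy_def)
  then have "(norm (momentum k - xstar))\<^sup>2 \<le> (norm (x 0 - xstar))\<^sup>2" using \<rho>_pos by simp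
  then show ?thesis by (rule power2_le_imp_le) simp
qed

text \<open>A serious iteration makes \<open>\<zeta> (Suc k)\<close> an average of
  \<open>momentum (Suc k)\<close> and \<open>\<zeta> k\<close>, both in the ball.\<close>

lemma \<zeta>_bound: "norm (\<zeta> k - xstar) \<le> norm (x 0 - xstar)"
proof (induction k)
  case 0
  then show ?case using run by (simp add: a_PBM_def)
next
  case (Suc k)
  show ?case
  proof (cases "serious k")
    case True
    show ?thesis
      by (rule norm_weighted_mean_le[OF t_ge_1[of k] _ momentum_bound[of "Suc k"] Suc])
        (simp add: momentum_serious[OF True])
  qed (simp add: null_update Suc)
qed

lemma x_bound: "norm (x k - xstar) \<le> norm (x 0 - xstar)"
  by (rule norm_weighted_mean_le[OF t_ge_1[of k] _ momentum_bound[of k] \<zeta>_bound[of k]])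
    (simp add: momentum_def)

text \<open>The cut at \<open>y 0\<close> is never dropped. Proximal optimality tested at
  \<open>y 0\<close>, together with this cut at \<open>?Y\<close>, leaves a quadratic inequality in
  \<open>norm d\<close>.\<close>

lemma y_step_bound: "norm (y (int (Suc k)) - y 0) \<le> norm (x k - y 0) + norm (grad f (y 0)) / \<rho>"
proof -
  let ?Y = "y (int (Suc k))"
  define d where "d = ?Y - y 0"
  have "f (y 0) \<ge> model k ?Y + \<rho> * ((x k - ?Y) \<bullet> (y 0 - ?Y))"
    using model_subgradient[of k "y 0"] model_cut(1)[OF zero_in_I] by simp
  moreover have "model k ?Y \<ge> f (y 0) + grad f (y 0) \<bullet> d"
    using model_above_tangent[OF zero_in_I] by (simp add: d_def)
  moreover have "(x k - ?Y) \<bullet> (y 0 - ?Y) = (norm d)\<^sup>2 - (x k - y 0) \<bullet> d"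
    by (simp add: d_def power2_norm_eq_inner inner_diff_left inner_diff_right inner_commute)
  ultimately have "\<rho> * (norm d)\<^sup>2 \<le> \<rho> * ((x k - y 0) \<bullet> d) + (- grad f (y 0)) \<bullet> d"
    by (simp add: right_diff_distrib)
  also have "\<dots> \<le> \<rho> * (norm (x k - y 0) * norm d) + norm (- grad f (y 0)) * norm d"
    using \<rho>_pos by (intro add_mono mult_left_mono norm_cauchy_schwarz) auto
  finally have "norm d * (\<rho> * norm d) \<le> norm d * (\<rho> * norm (x k - y 0) + norm (grad f (y 0)))"
    by (simp add: power2_eq_square algebra_simps)
  then have "\<rho> * norm d \<le> \<rho> * norm (x k - y 0) + norm (grad f (y 0))" if "norm d > 0"
    using that by (simp add: mult_le_cancel_left_pos)
  moreover have "norm (x k - y 0) + norm (grad f (y 0)) / \<rho> \<ge> 0" using \<rho>_pos by simp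
  ultimately show ?thesis
    using \<rho>_pos by (cases "norm d > 0") (auto simp: d_def field_simps)
qed

text \<open>One distance from \<open>y 0\<close> to \<open>xstar\<close> passes from
  \<open>y 0\<close> to \<open>xstar\<close>, the other from \<open>x k\<close> to
  \<open>y 0\<close>; the 1 ensures positivity.\<close>

definition radius :: real where
  "radius = norm (x 0 - xstar) + 2 * norm (y 0 - xstar) + norm (grad f (y 0)) / \<rho> + 1"

lemma radius_pos: "radius > 0"
  using \<rho>_pos unfolding radius_def by (smt (verit) divide_nonneg_pos norm_ge_zero)

lemma y_bound: "norm (y (int k) - xstar) \<le> radius"
proof (cases k)
  case 0
  then show ?thesis using \<rho>_pos unfolding radius_def by (smt (verit) divide_nonneg_pos norm_ge_zero of_nat_0)
next
  case (Suc j)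
  have "norm (y (int k) - xstar) \<le> norm (y (int (Suc j)) - y 0) + norm (y 0 - xstar)"
    unfolding Suc using norm_triangle_ineq[of "y (int (Suc j)) - y 0" "y 0 - xstar"] by simp
  also have "norm (y (int (Suc j)) - y 0) \<le> norm (x j - y 0) + norm (grad f (y 0)) / \<rho>"
    by (rule y_step_bound)
  also have "norm (x j - y 0) \<le> norm (x j - xstar) + norm (y 0 - xstar)"
    using norm_triangle_ineq4[of "x j - xstar" "y 0 - xstar"] by simp
  also have "norm (x j - xstar) \<le> norm (x 0 - xstar)" by (rule x_bound)
  finally show ?thesis unfolding radius_def by simp
qed

section \<open>The gap along null steps\<close>

abbreviation "prox_value k v \<equiv> f v + \<rho> / 2 * (norm (v - x k))\<^sup>2"
abbreviation "null_seq \<equiv> in_null_sequence L \<rho> y x"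
abbreviation "best \<equiv> best_point f \<rho> y x"
abbreviation "\<xi> \<equiv> gap f L \<rho> I y x"
abbreviation "value_at \<equiv> model_value f L \<rho> I y x"

lemma center_const:
  assumes "\<And>i. k \<le> i \<Longrightarrow> i < j \<Longrightarrow> \<not> serious i" "k \<le> j"
  shows "x j = x k"
  using assms(2,1)
proof (induction j rule: dec_induct)
  case (step n)
  then show ?case using null_update(1)[of n] by simp
qed simp

lemma null_seq_center: "null_seq k j \<Longrightarrow> x j = x k" "null_seq k j \<Longrightarrow> x (j - 1) = x k"
  by (rule center_const; force simp: in_null_sequence_def)+

lemma best_le:
  assumes "best k j z" "k < i" "i \<le> j"
  shows "prox_value k z \<le> prox_value k (y (int i))"
  using assms unfolding best_point_def is_arg_min_linorder by auto

lemma best_mono: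
  assumes "best k j z" "best k (Suc j) z'" "k < j"
  shows "prox_value k z' \<le> prox_value k z"
proof -
  have "z \<in> y ` {int k + 1..int j}" using assms(1) by (simp add: best_point_def is_arg_min_def)
  then have "z \<in> y ` {int k + 1..int (Suc j)}" by auto
  then show ?thesis using assms(2) unfolding best_point_def is_arg_min_linorder by blast
qed

lemma best_exists:
  assumes "k < j"
  shows "\<exists>z. best k j z"
proof -
  let ?S = "y ` {int k + 1..int j}"
  have "finite ?S" "?S \<noteq> {}" using assms by auto
  from ex_is_arg_min_if_finite[OF this, of "prox_value k"] show ?thesis by (simp add: best_point_def)
qed

lemma value_at_growth:
  assumes "null_seq k j"
  shows "model (j - 1) v + \<rho> / 2 * (norm (v - x k))\<^sup>2 \<ge> value_at k j + \<rho> / 2 * (norm (v - y (int j)))\<^sup>2"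
proof -
  have "Suc (j - 1) = j" using assms by (simp add: in_null_sequence_def)
  with model_growth[of "j - 1" v] null_seq_center(2)[OF assms] show ?thesis
    by (simp add: model_value_def del: of_nat_diff)
qed

lemma value_at_Suc:
  assumes "null_seq k j"
  shows "model j (y (int (Suc j))) + \<rho> / 2 * (norm (y (int (Suc j)) - x k))\<^sup>2
    \<ge> value_at k j + \<rho> / 2 * (norm (y (int (Suc j)) - y (int j)))\<^sup>2"
proof -
  have "Suc (j - 1) = j" using assms by (simp add: in_null_sequence_def)
  then have "model (j - 1) (y (int (Suc j))) \<le> model j (y (int (Suc j)))"
    using model_mono[of "j - 1"] by metis
  then show ?thesis using value_at_growth[OF assms, of "y (int (Suc j))"] by linarith
qed

text \<open>With a single candidate the proximal terms cancel and the gap is the model error. As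
  \<open>y (int k)\<close> may stem from an earlier center, the step is bounded by twice the uniform
  radius.\<close>

lemma gap_initial:
  assumes "best k (Suc k) z"
  shows "\<xi> k (Suc k) z \<le> 2 * L * radius\<^sup>2"
proof -
  have "z = y (int (Suc k))" using assms by (auto simp: best_point_def is_arg_min_def add.commute)
  then have "\<xi> k (Suc k) z = f (y (int (Suc k))) - model k (y (int (Suc k)))"
    by (simp add: gap_def model_value_def)
  also have "\<dots> \<le> L / 2 * (norm (y (int (Suc k)) - y (int k)))\<^sup>2" by (rule model_error)
  also have "\<dots> \<le> L / 2 * (2 * radius)\<^sup>2"
  proof (intro mult_left_mono power_mono)
    show "norm (y (int (Suc k)) - y (int k)) \<le> 2 * radius"
      using norm_triangle_ineq4[of "y (int (Suc k)) - xstar" "y (int k) - xstar"]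
        y_bound[of k] y_bound[of "Suc k"] by (simp del: of_nat_Suc)
  qed (use L_pos in auto)
  finally show ?thesis by (simp add: power_mult_distrib)
qed

lemma gap_contraction:
  assumes "null_seq k j" "null_seq k (Suc j)" "best k j z" "best k (Suc j) z'"
  shows "(1 + \<rho> / L) * \<xi> k (Suc j) z' \<le> \<xi> k j z"
proof -
  let ?Y = "y (int (Suc j))"
  define s where "s = (norm (?Y - y (int j)))\<^sup>2"
  have kj: "k < j" using assms(1) by (simp add: in_null_sequence_def)
  have v: "value_at k (Suc j) = model j ?Y + \<rho> / 2 * (norm (?Y - x k))\<^sup>2"
    by (simp add: model_value_def)
  have "\<xi> k (Suc j) z' \<le> f ?Y - model j ?Y"
    using best_le[OF assms(4), of "Suc j"] kj by (simp add: gap_def v)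
  also have "\<dots> \<le> L / 2 * s" unfolding s_def by (rule model_error)
  \<comment> \<open>The scaling matches the increase \<open>\<rho> / 2 * s\<close> of the model
    value, so \<open>s\<close> is eliminated.\<close>
  finally have "\<rho> / L * \<xi> k (Suc j) z' \<le> \<rho> / L * (L / 2 * s)"
    using L_pos \<rho>_pos by (intro mult_left_mono) auto
  then have "\<rho> / L * \<xi> k (Suc j) z' \<le> \<rho> / 2 * s" using L_pos by simp
  moreover have "\<xi> k (Suc j) z' + \<rho> / 2 * s \<le> \<xi> k j z"
    using value_at_Suc[OF assms(1)] best_mono[OF assms(3,4) kj] unfolding gap_def v s_def by linarith
  ultimately show ?thesis unfolding distrib_right by linarith
qed

lemma gap_decay:
  assumes "null_seq k (Suc (k + p))" "best k (Suc (k + p)) z"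
  shows "(1 + \<rho> / L) ^ p * \<xi> k (Suc (k + p)) z \<le> 2 * L * radius\<^sup>2"
  using assms
proof (induction p arbitrary: z)
  case 0
  then show ?case using gap_initial by simp
next
  case (Suc p)
  have null: "null_seq k (Suc (k + p))" using Suc.prems(1) by (simp add: in_null_sequence_def)
  obtain w where w: "best k (Suc (k + p)) w" using best_exists[of k "Suc (k + p)"] by auto
  have "(1 + \<rho> / L) ^ p * ((1 + \<rho> / L) * \<xi> k (Suc (Suc (k + p))) z) \<le> (1 + \<rho> / L) ^ p * \<xi> k (Suc (k + p)) w"
    using gap_contraction[OF null _ w, of z] Suc.prems L_pos \<rho>_pos by (intro mult_left_mono) auto
  also have "\<dots> \<le> 2 * L * radius\<^sup>2" by (rule Suc.IH[OF null w])
  finally show ?case by (simp add: mult_ac)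
qed

section \<open>Optimality from a small gap\<close>

text \<open>Collects the losses in \<open>null_step_accuracy\<close>: the model slope towards
  \<open>xstar\<close>, two quadratic terms, and the passage from the best point to
  \<open>y (int j)\<close>. The 1 makes \<open>\<epsilon> / error_slope\<close> at most 1.\<close>

definition error_slope :: real where
  "error_slope = (let C = step_const L \<rho> in
    1 + \<rho> * (C + 1) * radius + \<rho> / 2 * (C + 1)\<^sup>2 + \<rho> / 2 + L * radius)"

text \<open>Chosen so that \<open>gap_threshold * \<epsilon>\<^sup>2\<close> is
  \<open>\<rho> / 2\<close> times the square of \<open>\<epsilon> / error_slope\<close>.\<close>

definition gap_threshold :: real where
  "gap_threshold = \<rho> / (2 * error_slope\<^sup>2)"

lemma step_const_pos: "step_const L \<rho> > 0"
  using L_pos \<rho>_pos unfolding step_const_def by (intro mult_pos_pos divide_pos_pos add_nonneg_pos) auto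

lemma error_slope_ge_1: "error_slope \<ge> 1"
  using L_pos \<rho>_pos step_const_pos radius_pos by (simp add: error_slope_def Let_def)

lemma gap_threshold_pos: "gap_threshold > 0"
  using \<rho>_pos error_slope_ge_1 by (simp add: gap_threshold_def)

lemma null_step_accuracy:
  assumes null: "null_seq k j" "\<not> serious j" and z: "best k j z"
    and \<delta>: "\<xi> k j z \<le> \<rho> / 2 * \<delta>\<^sup>2" "0 < \<delta>" "\<delta> \<le> 1"
  shows "f (y (int j)) - f xstar \<le> error_slope * \<delta>"
proof -
  let ?Y = "y (int j)" and ?Y' = "y (int (Suc j))"
  define C where "C = step_const L \<rho>"
  have C: "C > 0" using step_const_pos by (simp add: C_def)
  have Suc_j: "Suc (j - 1) = j" using null by (simp add: in_null_sequence_def)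
  have gap: "prox_value k z = value_at k j + \<xi> k j z" by (simp add: gap_def)
  \<comment> \<open>Strong convexity will put the quadratic of each displacement from
    \<open>?Y\<close> below the gap.\<close>
  have le: "norm u \<le> \<delta>" if "\<rho> / 2 * (norm u)\<^sup>2 \<le> \<xi> k j z" for u :: 'a
  proof -
    have "\<rho> / 2 * (norm u)\<^sup>2 \<le> \<rho> / 2 * \<delta>\<^sup>2" using that \<delta>(1) by linarith
    then have "(norm u)\<^sup>2 \<le> \<delta>\<^sup>2" using \<rho>_pos by simp
    then show ?thesis using \<delta>(2) by (rule power2_le_imp_le[OF _ less_imp_le])
  qed
  have zY: "norm (z - ?Y) \<le> \<delta>"
    using value_at_growth[OF null(1), of z] model_le[of "j - 1" z] gap by (intro le) linarith
  have "model j ?Y' + \<rho> / 2 * (norm (?Y' - x k))\<^sup>2 \<le> model j z + \<rho> / 2 * (norm (z - x k))\<^sup>2"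
  proof -
    have "\<rho> / 2 * (norm (z - ?Y'))\<^sup>2 \<ge> 0" using \<rho>_pos by simp
    then show ?thesis using model_growth[of j z] null_seq_center(1)[OF null(1)] by (simp del: of_nat_Suc)
  qed
  then have YY': "norm (?Y' - ?Y) \<le> \<delta>"
    using value_at_Suc[OF null(1)] model_le[of j z] gap by (intro le) linarith
  \<comment> \<open>The failed test converts closeness of consecutive points into closeness to the
    center.\<close>
  have "norm (x k - ?Y') < C * norm (?Y' - ?Y)"
    using null(2) null_seq_center(1)[OF null(1)] unfolding serious_iff C_def by simp
  also have "\<dots> \<le> C * \<delta>" using YY' C by (intro mult_left_mono) auto
  finally have "norm (x k - ?Y) \<le> C * \<delta> + \<delta>"
    using YY' norm_triangle_ineq[of "x k - ?Y'" "?Y' - ?Y"] by simp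
  then have xY: "norm (x k - ?Y) \<le> (C + 1) * \<delta>" by (simp add: algebra_simps)
  have r: "norm (?Y - xstar) \<le> radius" by (rule y_bound)
  have "model (j - 1) xstar \<ge> model (j - 1) ?Y + \<rho> * ((x k - ?Y) \<bullet> (xstar - ?Y))"
    using model_subgradient[of "j - 1" xstar] null_seq_center(2)[OF null(1)] unfolding Suc_j by simp
  moreover have "(x k - ?Y) \<bullet> (?Y - xstar) \<le> (C + 1) * \<delta> * radius"
    using xY r norm_cauchy_schwarz[of "x k - ?Y" "?Y - xstar"]
    by (smt (verit) mult_mono norm_ge_zero)
  then have "\<rho> * ((x k - ?Y) \<bullet> (?Y - xstar)) \<le> \<rho> * ((C + 1) * \<delta> * radius)"
    using \<rho>_pos by (intro mult_left_mono) auto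
  moreover have "\<rho> * ((x k - ?Y) \<bullet> (?Y - xstar)) = - (\<rho> * ((x k - ?Y) \<bullet> (xstar - ?Y)))"
    by (simp add: inner_diff_right right_diff_distrib)
  ultimately have 1: "model (j - 1) ?Y \<le> f xstar + \<rho> * ((C + 1) * \<delta> * radius)"
    using model_le[of "j - 1" xstar] by linarith
  have "\<rho> / 2 * (norm (?Y - x k))\<^sup>2 \<le> \<rho> / 2 * ((C + 1) * \<delta>)\<^sup>2"
    using xY \<rho>_pos by (intro mult_left_mono power_mono) (auto simp: norm_minus_commute)
  moreover have "\<rho> / 2 * (norm (z - x k))\<^sup>2 \<ge> 0" using \<rho>_pos by simp
  ultimately have 2: "f z \<le> model (j - 1) ?Y + \<rho> / 2 * ((C + 1) * \<delta>)\<^sup>2 + \<rho> / 2 * \<delta>\<^sup>2"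
    using gap \<delta>(1) unfolding model_value_def by linarith
  have "grad f xstar = 0"
    using minimizer by (intro subgradient_eq_grad[OF smooth]) simp
  then have "norm (grad f ?Y) \<le> L * norm (xstar - ?Y)"
    using smooth unfolding L_smooth_def by (metis diff_zero)
  also have "\<dots> \<le> L * radius" using r L_pos by (simp add: norm_minus_commute)
  finally have "grad f ?Y \<bullet> (?Y - z) \<le> L * radius * \<delta>"
    using zY norm_cauchy_schwarz[of "grad f ?Y" "?Y - z"]
    by (smt (verit) mult_mono norm_ge_zero norm_minus_commute)
  then have 3: "f ?Y \<le> f z + L * radius * \<delta>"
    using convex_smooth_above_tangent[OF convex smooth, of ?Y z] by (simp add: inner_diff_right)
  \<comment> \<open>The quadratic terms are absorbed into the linear slope.\<close>
  have "\<delta>\<^sup>2 \<le> \<delta>" using \<delta> by (simp add: power2_eq_square mult_left_le)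
  then have "\<rho> / 2 * ((C + 1)\<^sup>2 + 1) * \<delta>\<^sup>2 \<le> \<rho> / 2 * ((C + 1)\<^sup>2 + 1) * \<delta>"
    using \<rho>_pos by (intro mult_left_mono) auto
  moreover have "error_slope * \<delta> = \<delta> + \<rho> * ((C + 1) * \<delta> * radius) + \<rho> / 2 * ((C + 1)\<^sup>2 + 1) * \<delta> + L * radius * \<delta>"
    by (simp add: error_slope_def Let_def C_def[symmetric] algebra_simps)
  moreover have "\<rho> / 2 * ((C + 1) * \<delta>)\<^sup>2 + \<rho> / 2 * \<delta>\<^sup>2 = \<rho> / 2 * ((C + 1)\<^sup>2 + 1) * \<delta>\<^sup>2"
    unfolding power_mult_distrib by (simp add: algebra_simps)
  ultimately show ?thesis using 1 2 3 \<delta>(2) by linarith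
qed

lemma null_step_optimal:
  assumes "null_seq k j" "\<not> serious j" "best k j z"
    and "\<xi> k j z \<le> gap_threshold * \<epsilon> ^ 3" "0 < \<epsilon>" "\<epsilon> < 1"
  shows "f (y (int j)) - f xstar \<le> \<epsilon>"
proof -
  define \<delta> where "\<delta> = \<epsilon> / error_slope"
  \<comment> \<open>The square is the order that \<open>null_step_accuracy\<close> handles with this
    \<open>\<delta>\<close>.\<close>
  have "\<epsilon> ^ 3 \<le> \<epsilon>\<^sup>2" using assms by (intro power_decreasing) auto
  then have "gap_threshold * \<epsilon> ^ 3 \<le> gap_threshold * \<epsilon>\<^sup>2"
    using gap_threshold_pos by (intro mult_left_mono) auto
  also have "\<dots> = \<rho> / 2 * \<delta>\<^sup>2"
    by (simp add: \<delta>_def gap_threshold_def power_divide)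
  finally have "\<xi> k j z \<le> \<rho> / 2 * \<delta>\<^sup>2" using assms(4) by linarith
  moreover have "0 < \<delta>" "\<delta> \<le> 1" using assms(5,6) error_slope_ge_1 by (auto simp: \<delta>_def)
  ultimately have "f (y (int j)) - f xstar \<le> error_slope * \<delta>"
    using assms by (intro null_step_accuracy)
  then show ?thesis using error_slope_ge_1 by (simp add: \<delta>_def)
qed

section \<open>Iteration count\<close>

text \<open>Iterations \<open>k\<close> to \<open>k + p\<close> contract the initial gap
  \<open>p\<close> times; iteration \<open>Suc (k + p)\<close> is the failed test that
  \<open>null_step_optimal\<close> asks for. This makes \<open>p + 2\<close> iterations in
  all.\<close>

lemma null_sequence_length:
  assumes \<epsilon>: "0 < \<epsilon>" "\<epsilon> < 1" and p: "2 * L * radius\<^sup>2 \<le> gap_threshold * \<epsilon> ^ 3 * (1 + \<rho> / L) ^ p"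
    and null: "\<And>i. k \<le> i \<Longrightarrow> i \<le> Suc (k + p) \<Longrightarrow> \<not> serious i"
  shows "f (y (int (Suc (k + p)))) - f xstar \<le> \<epsilon>"
proof -
  have ns: "null_seq k (Suc (k + p))" using null by (auto simp: in_null_sequence_def)
  obtain z where z: "best k (Suc (k + p)) z" using best_exists[of k "Suc (k + p)"] by auto
  have "(1 + \<rho> / L) ^ p * \<xi> k (Suc (k + p)) z \<le> (1 + \<rho> / L) ^ p * (gap_threshold * \<epsilon> ^ 3)"
    using gap_decay[OF ns z] p by (simp add: mult_ac)
  moreover have "(1 + \<rho> / L) ^ p > 0" using L_pos \<rho>_pos by (simp add: add_pos_pos)
  ultimately have "\<xi> k (Suc (k + p)) z \<le> gap_threshold * \<epsilon> ^ 3" by (simp add: mult_le_cancel_left_pos)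
  then show ?thesis using null \<epsilon> ns z by (intro null_step_optimal) auto
qed

text \<open>A block of \<open>p + 2\<close> iterations either contains a serious one, which raises
  \<open>t\<close> by at least 1/2, or consists of null steps and yields an optimal point.\<close>

lemma serious_count:
  assumes \<epsilon>: "0 < \<epsilon>" "\<epsilon> < 1" and p: "2 * L * radius\<^sup>2 \<le> gap_threshold * \<epsilon> ^ 3 * (1 + \<rho> / L) ^ p"
  shows "(\<exists>N\<ge>1. N \<le> s * (p + 2) \<and> f (y (int N)) - f xstar \<le> \<epsilon>) \<or>
    (\<exists>k\<le>s * (p + 2). t k \<ge> 1 + real s / 2)"
proof (induction s)
  case 0
  then show ?case using t_ge_1[of 0] by auto
next
  case (Suc s)
  then show ?case
  proof (elim disjE exE conjE)
    fix N assume "1 \<le> N" "N \<le> s * (p + 2)" "f (y (int N)) - f xstar \<le> \<epsilon>"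
    then show ?thesis by (intro disjI1 exI[of _ N]) auto
  next
    fix k assume k: "k \<le> s * (p + 2)" "1 + real s / 2 \<le> t k"
    show ?thesis
    proof (cases "\<exists>i\<in>{k..Suc (k + p)}. serious i")
      case True
      then obtain i where i: "k \<le> i" "i \<le> Suc (k + p)" "serious i" by auto
      have "t (Suc i) \<ge> 1 + real (Suc s) / 2"
        using t_serious(2)[OF i(3)] t_mono[OF i(1)] k(2) by (simp add: add_divide_distrib)
      then show ?thesis using i(2) k(1) by (intro disjI2 exI[of _ "Suc i"]) auto
    next
      case False
      then have "f (y (int (Suc (k + p)))) - f xstar \<le> \<epsilon>" by (intro null_sequence_length[OF \<epsilon> p]) auto
      then show ?thesis using k(1) by (intro disjI1 exI[of _ "Suc (k + p)"]) auto
    qed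
  qed
qed

text \<open>The energy weight is at least \<open>s\<^sup>2 / 4\<close>, and the lower bound on
  \<open>s\<close> says that the initial energy is at most
  \<open>s\<^sup>2 / 4 * \<epsilon>\<close>.\<close>

lemma \<zeta>_optimal:
  assumes \<epsilon>: "\<epsilon> > 0" and t: "t k \<ge> 1 + s / 2"
    and s: "s > 0" "s \<ge> sqrt (2 * \<rho>) * norm (x 0 - xstar) / sqrt \<epsilon>"
  shows "f (\<zeta> k) - f xstar \<le> \<epsilon>"
proof -
  define \<Delta> where "\<Delta> = f (\<zeta> k) - f xstar"
  have \<Delta>: "\<Delta> \<ge> 0" using minimizer by (simp add: \<Delta>_def)
  have "s\<^sup>2 / 4 \<le> (1 + s / 2) * (s / 2)" using s(1) by (simp add: power2_eq_square algebra_simps)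
  also have "\<dots> \<le> t k * (t k - 1)" using t s(1) by (intro mult_mono) auto
  finally have "s\<^sup>2 / 4 * \<Delta> \<le> t k * (t k - 1) * \<Delta>" using \<Delta> by (intro mult_right_mono)
  also have "\<dots> \<le> energy k"
    using \<rho>_pos by (simp add: energy_def \<Delta>_def power2_eq_square algebra_simps)
  also have "\<dots> \<le> \<rho> / 2 * (norm (x 0 - xstar))\<^sup>2" by (rule energy_le)
  also have "\<dots> \<le> s\<^sup>2 / 4 * \<epsilon>"
  proof -
    have "sqrt (2 * \<rho>) * norm (x 0 - xstar) \<le> s * sqrt \<epsilon>" using s(2) \<epsilon> by (simp add: field_simps)
    then have "(sqrt (2 * \<rho>) * norm (x 0 - xstar))\<^sup>2 \<le> (s * sqrt \<epsilon>)\<^sup>2"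
      using \<rho>_pos by (intro power_mono) auto
    then show ?thesis using \<rho>_pos \<epsilon> by (simp add: power_mult_distrib)
  qed
  finally show ?thesis using s(1) by (simp add: \<Delta>_def)
qed

end

theorem theorem26:
  fixes f :: "'a::euclidean_space \<Rightarrow> real"
    and L \<rho> :: real
    and xstar :: 'a
    and I :: "nat \<Rightarrow> int set"
    and y :: "int \<Rightarrow> 'a"
    and x \<zeta> :: "nat \<Rightarrow> 'a"
    and t :: "nat \<Rightarrow> real"
  assumes "convex_on UNIV f"
    and "L_smooth L f"
    and "\<forall>u. f xstar \<le> f u"
    and "\<rho> > 0"
    and "a_PBM f L \<rho> I y x \<zeta> t"
  shows "\<exists>A>0. \<exists>M>0. \<forall>\<epsilon>::real. 0 < \<epsilon> \<and> \<epsilon> < 1 \<longrightarrow>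
    (\<forall>k j z. serious_step L \<rho> y x k \<and> in_null_sequence L \<rho> y x k j \<and>
        best_point f \<rho> y x k j z \<and> gap f L \<rho> I y x k j z \<le> A * \<epsilon> ^ 3 \<and>
        \<not> serious_iteration L \<rho> y x j
        \<longrightarrow> f (y (int j)) - f xstar \<le> \<epsilon>) \<and>
    (\<forall>k z. serious_step L \<rho> y x k \<and> best_point f \<rho> y x k (k + 1) z
        \<longrightarrow> gap f L \<rho> I y x k (k + 1) z \<le> M / \<epsilon>\<^sup>2) \<and>
    (\<exists>N::nat. real N \<le>
        (sqrt (2 * \<rho>) * norm (x 0 - xstar) / sqrt \<epsilon> + 1) *
        ((5 * ln (1 / \<epsilon>) + ln (M / A)) /
           ln (1 + inverse (L / \<rho> + 8 * L\<^sup>2 / \<rho>\<^sup>2 + 16 * L ^ 3 / \<rho> ^ 3)) + 1) \<and>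
        (f (\<zeta> N) - f xstar \<le> \<epsilon> \<or> N \<ge> 1 \<and> f (y (int N)) - f xstar \<le> \<epsilon>))"
proof -
  interpret accelerated_bundle f L \<rho> xstar I y x \<zeta> t
    using assms by unfold_locales auto
  define A where "A = gap_threshold"
  define G where "G = 2 * L * radius\<^sup>2"
  define r' where "r' = 1 + inverse (L / \<rho> + 8 * L\<^sup>2 / \<rho>\<^sup>2 + 16 * L ^ 3 / \<rho> ^ 3)"
  define r where "r = 1 + \<rho> / L"
  \<comment> \<open>The factor \<open>r'\<^sup>2\<close> pays for rounding up and for the first and last iteration of a null sequence.\<close>
  define M where "M = max G A * r'\<^sup>2"
  have A: "A > 0" unfolding A_def by (rule gap_threshold_pos)
  \<comment> \<open>The higher-order terms only enlarge the sum being inverted, so the claimed rate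
    is no better than the proved one.\<close>
  have r': "1 < r'" "r' \<le> r"
  proof -
    have "0 < L / \<rho>" "L / \<rho> \<le> L / \<rho> + 8 * L\<^sup>2 / \<rho>\<^sup>2 + 16 * L ^ 3 / \<rho> ^ 3"
      using L_pos \<rho>_pos by auto
    then have "0 < inverse (L / \<rho> + 8 * L\<^sup>2 / \<rho>\<^sup>2 + 16 * L ^ 3 / \<rho> ^ 3)"
      "inverse (L / \<rho> + 8 * L\<^sup>2 / \<rho>\<^sup>2 + 16 * L ^ 3 / \<rho> ^ 3) \<le> inverse (L / \<rho>)"
      by (linarith | intro positive_imp_inverse_positive le_imp_inverse_le)+
    then show "1 < r'" "r' \<le> r" unfolding r'_def r_def by simp_all
  qed
  have M: "M > 0" "G \<le> M"
  proof -
    have "max G A * 1 \<le> M" unfolding M_def using r' A by (intro mult_left_mono) (auto simp: one_le_power)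
    then show "M > 0" "G \<le> M" using A by auto
  qed
  have main: "\<exists>N::nat. real N \<le>
      (sqrt (2 * \<rho>) * norm (x 0 - xstar) / sqrt \<epsilon> + 1) * ((5 * ln (1 / \<epsilon>) + ln (M / A)) / ln r' + 1) \<and>
      (f (\<zeta> N) - f xstar \<le> \<epsilon> \<or> N \<ge> 1 \<and> f (y (int N)) - f xstar \<le> \<epsilon>)"
    if \<epsilon>: "0 < \<epsilon>" "\<epsilon> < 1" for \<epsilon>
  proof -
    define a where "a = sqrt (2 * \<rho>) * norm (x 0 - xstar) / sqrt \<epsilon>"
    \<comment> \<open>Positive even for \<open>a = 0\<close>, as \<open>\<zeta>_optimal\<close>
      requires, and still at most \<open>a + 1\<close>.\<close>
    define s where "s = nat \<lfloor>a\<rfloor> + 1"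
    \<comment> \<open>The maximum makes \<open>Q\<close>, and with it \<open>X\<close>, nonnegative,
      so the truncation in \<open>p\<close> is harmless.\<close>
    define Q where "Q = ln (max G A / A)"
    define X where "X = (3 * ln (1 / \<epsilon>) + Q) / ln r"
    define p where "p = nat \<lceil>X\<rceil>"
    have a: "a \<ge> 0" using \<rho>_pos \<epsilon> by (simp add: a_def)
    have s: "real s \<ge> a" "real s \<le> a + 1" using a by (auto simp: s_def) linarith+
    have Q: "Q \<ge> 0" using A by (simp add: Q_def)
    have le: "ln (1 / \<epsilon>) \<ge> 0" using \<epsilon> by simp
    have lnr: "0 < ln r'" "ln r' \<le> ln r" using r' by auto
    have X: "X \<ge> 0" using Q le lnr by (simp add: X_def)
    have p: "real p \<ge> X" "real p \<le> X + 1" using X by (auto simp: p_def)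
    have "3 * ln (1 / \<epsilon>) + Q \<le> real p * ln r" using p(1) lnr by (simp add: X_def pos_divide_le_eq)
    then have "exp (3 * ln (1 / \<epsilon>) + Q) \<le> exp (real p * ln r)" by simp
    moreover have "exp (3 * ln (1 / \<epsilon>) + Q) = (1 / \<epsilon>) ^ 3 * (max G A / A)"
      using \<epsilon> A by (simp add: exp_add Q_def exp_of_nat_mult[of 3, simplified])
    moreover have "exp (real p * ln r) = r ^ p" using r' by (simp add: exp_of_nat_mult)
    ultimately have "(1 / \<epsilon>) ^ 3 * (max G A / A) \<le> r ^ p" by linarith
    then have "A * \<epsilon> ^ 3 * ((1 / \<epsilon>) ^ 3 * (max G A / A)) \<le> A * \<epsilon> ^ 3 * r ^ p"
      using \<epsilon> A by (intro mult_left_mono) auto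
    moreover have "A * \<epsilon> ^ 3 * ((1 / \<epsilon>) ^ 3 * (max G A / A)) = max G A"
      using \<epsilon> A by (simp add: power_divide)
    ultimately have "G \<le> A * \<epsilon> ^ 3 * r ^ p" by linarith
    then have "2 * L * radius\<^sup>2 \<le> gap_threshold * \<epsilon> ^ 3 * (1 + \<rho> / L) ^ p"
      by (simp add: A_def G_def r_def)
    from serious_count[OF \<epsilon> this, of s]
    obtain N where N: "N \<le> s * (p + 2)"
      "f (\<zeta> N) - f xstar \<le> \<epsilon> \<or> N \<ge> 1 \<and> f (y (int N)) - f xstar \<le> \<epsilon>"
    proof (elim disjE exE conjE)
      fix k assume "k \<le> s * (p + 2)" "1 + real s / 2 \<le> t k"
      then show thesis
        using \<zeta>_optimal[OF \<epsilon>(1), of "real s" k] s(1) by (intro that[of k]) (auto simp: a_def s_def)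
    qed (use that in blast)
    \<comment> \<open>Since \<open>ln (1 / \<epsilon>)\<close> is nonnegative, the factor 5 absorbs
      the 3; the smaller \<open>ln r'\<close> enlarges the quotient.\<close>
    have "X \<le> (5 * ln (1 / \<epsilon>) + Q) / ln r'"
      unfolding X_def using lnr le Q by (intro frac_le) auto
    moreover have "ln (M / A) = Q + 2 * ln r'"
    proof -
      have "M / A = max G A / A * r'\<^sup>2" by (simp add: M_def)
      moreover have "max G A / A > 0" using A by (simp add: less_max_iff_disj)
      moreover have "r'\<^sup>2 > 0" using r' by simp
      moreover have "ln (r'\<^sup>2) = 2 * ln r'" using r' ln_realpow[of r' 2] by simp
      ultimately show ?thesis using ln_mult_pos[of "max G A / A" "r'\<^sup>2"] by (metis Q_def)
    qed
    then have "(5 * ln (1 / \<epsilon>) + ln (M / A)) / ln r' = (5 * ln (1 / \<epsilon>) + Q) / ln r' + 2"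
      using lnr by (simp add: add_divide_distrib)
    ultimately have K: "real p + 2 \<le> (5 * ln (1 / \<epsilon>) + ln (M / A)) / ln r' + 1"
      using p(2) by linarith
    have "real N \<le> real (s * (p + 2))" using N(1) by (simp only: of_nat_le_iff)
    also have "\<dots> = real s * (real p + 2)" by (simp add: algebra_simps)
    also have "\<dots> \<le> (a + 1) * ((5 * ln (1 / \<epsilon>) + ln (M / A)) / ln r' + 1)"
      using s(2) K a by (intro mult_mono) auto
    finally show ?thesis using N(2) unfolding a_def by blast
  qed
  have initial: "gap f L \<rho> I y x k (k + 1) z \<le> M / \<epsilon>\<^sup>2"
    if "0 < \<epsilon>" "\<epsilon> < 1" "best_point f \<rho> y x k (k + 1) z" for \<epsilon> k z
  proof -
    have "gap f L \<rho> I y x k (k + 1) z \<le> G" using gap_initial that(3) by (simp add: G_def)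
    also have "\<dots> \<le> M / 1" using M by simp
    also have "\<dots> \<le> M / \<epsilon>\<^sup>2" using that M by (intro divide_left_mono) (auto simp: power_le_one)
    finally show ?thesis .
  qed
  show ?thesis
    unfolding r'_def[symmetric]
  proof (rule exI[of _ A], rule conjI[OF A], rule exI[of _ M], rule conjI[OF M(1)],
      intro allI impI, elim conjE, intro conjI)
    fix \<epsilon> :: real assume \<epsilon>: "0 < \<epsilon>" "\<epsilon> < 1"
    show "\<forall>k j z. serious_step L \<rho> y x k \<and> null_seq k j \<and> best k j z \<and>
        \<xi> k j z \<le> A * \<epsilon> ^ 3 \<and> \<not> serious j \<longrightarrow> f (y (int j)) - f xstar \<le> \<epsilon>"
      using null_step_optimal[OF _ _ _ _ \<epsilon>] unfolding A_def by blast
    show "\<forall>k z. serious_step L \<rho> y x k \<and> best k (k + 1) z \<longrightarrow> \<xi> k (k + 1) z \<le> M / \<epsilon>\<^sup>2"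
      using initial[OF \<epsilon>] by blast
  qed (rule main)
qed

end
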